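(* Let $k=-q<0$, $b>0$, and suppose that the line $\Gamma$: $y=-qx-b$ and the switching curve $S$ have three intersection points (equivalently, $2bq<1$). Consider the time-optimal problem with the state constraint $y\ge -qx-b$. Then the optimal synthesis is as follows. (i) In the sets $\Omega_1$ and $\Omega_2$ it is the same as in the free problem (the problem without the state constraint), i.e. the optimal trajectory goes either with the control $u=(-1,+1)$ or with the control $u=(+1,-1)$. (ii) From the points of $\Omega_3$ the optimal trajectory moves with control $u=-1$ to the segment $[F,C]$ of the state boundary $\Gamma$, then goes along this segment in the left–up direction until the point $F$, and then with control $u=+1$ to the origin. (iii) From the points of $\Omega_4$ the optimal trajectory goes with control $u=-1$ to the parabola arc $[C,C'')$, then along this arc with control $u=+1$ to the point $C$, then goes along the segment $[C,F]$ of the state boundary $\Gamma$ to the point $F$, and at the point $F$ the control switches to $u=+1$ and the trajectory gets to the origin. (Individual legs may degenerate to a point.)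
   Context: Problem: on $[0,T]$ with $T$ free, $\dot x=y$, $\dot y=u$, $x(0)=x_0$, $y(0)=y_0$, $x(T)=0$, $y(T)=0$, $|u|\le 1$, $T\to\min$, under the state constraint $y\ge kx-b=-qx-b$ on $[0,T]$. Controls $u$ are measurable; $x,y$ are Lipschitz. The free problem is the same problem without the state constraint. The notation $u=(u_1,u_2)$ means that $u=u_1$ a.e. on $[0,t_1]$ and $u=u_2$ a.e. on $[t_1,T]$ for some $t_1$. Motion along $\Gamma$ has control $u=-qy$. $S$ is the switching curve of the free problem, the union of the semi-parabolas $x=-\tfrac12y^2,\ y\ge0$ and $x=\tfrac12y^2,\ y\le0$; write it as $x=s(y)$ with $s(y)=-\frac12y^2$ for $y\ge0$ and $s(y)=\frac12y^2$ for $y\le0$. Characteristic points: $C=\left(\frac{1-bq}{q^2},-\frac1q\right)$ is the point where $\Gamma$ is tangent to a parabola of the family $x=\frac12y^2+\mathrm{const}$; $F=(x_F,y_F)$ is the intersection point of $\Gamma$ with the right branch of $S$ lying above $C$, $y_F=\frac{-1+\sqrt{1-2bq}}{q}$, $x_F=\frac12y_F^2$. Arcs: $[F,F')$ is the arc $x=-\frac12y^2+y_F^2$, $y\ge y_F$ (through $F$, $u=-1$); $[C,C')$ is the arc $x=-\frac12y^2+n$, $y\ge-1/q$, with $n=\frac{3-2bq}{2q^2}$ (through $C$, $u=-1$); $[C,C'')$ is the arc $x=\frac12y^2+\frac{1-2bq}{2q^2}$, $y\le-1/q$ (through $C$, $u=+1$). Closed sets, all contained in $\{y\ge-qx-b\}$: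 $\Omega_1$ (bounded by $\Gamma$ and $S$): all $(x,y)$ with $y\ge-qx-b$, $y\ge y_F$, $x\le s(y)$. $\Omega_2$ (between $S$ and $[F,F')$): all $(x,y)$ with $y\ge-qx-b$, $y\ge y_F$, $s(y)\le x\le y_F^2-\frac12y^2$. $\Omega_3$ (bounded by $\Gamma$, $[F,F')$ and $[C,C')$): all $(x,y)$ with $y\ge-qx-b$, $y\ge-1/q$, $x\le n-\frac12y^2$, and, if $y\ge y_F$, also $x\ge y_F^2-\frac12y^2$. $\Omega_4$ (bounded by $[C,C')$ and $[C,C'')$): all $(x,y)$ with $y\ge-qx-b$ such that either $y\ge-1/q$ and $x\ge n-\frac12y^2$, or $y\le-1/q$ and $x\ge\frac12y^2+\frac{1-2bq}{2q^2}$. *)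

theory Defs
  imports "HOL-Analysis.Analysis"
begin

text \<open>
  A process \<open>(T, x, y, u)\<close> is considered on \<open>[0, T]\<close> only; values of \<open>x\<close>, \<open>y\<close>, \<open>u\<close> outside this
  interval are irrelevant. The case \<open>T = 0\<close> is allowed, so that the problem
  has a solution when the initial point is the origin.
\<close>

definition free_process ::
  "real \<Rightarrow> real \<Rightarrow> real \<Rightarrow> (real \<Rightarrow> real) \<Rightarrow> (real \<Rightarrow> real) \<Rightarrow> (real \<Rightarrow> real) \<Rightarrow> bool" where
  "free_process x0 y0 T x y u \<longleftrightarrow>
     0 \<le> T \<and>
     u \<in> borel_measurable (lebesgue_on {0..T}) \<and>
     (AE t in lebesgue_on {0..T}. \<bar>u t\<bar> \<le> 1) \<and>
     (\<exists>L. L-lipschitz_on {0..T} x) \<and>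
     (\<exists>L. L-lipschitz_on {0..T} y) \<and>
     (AE t in lebesgue_on {0..T}. (x has_real_derivative y t) (at t within {0..T})) \<and>
     (AE t in lebesgue_on {0..T}. (y has_real_derivative u t) (at t within {0..T})) \<and>
     x 0 = x0 \<and> y 0 = y0 \<and> x T = 0 \<and> y T = 0"

definition constrained_process ::
  "real \<Rightarrow> real \<Rightarrow> real \<Rightarrow> real \<Rightarrow> real \<Rightarrow> (real \<Rightarrow> real) \<Rightarrow> (real \<Rightarrow> real) \<Rightarrow> (real \<Rightarrow> real) \<Rightarrow> bool" where
  "constrained_process q b x0 y0 T x y u \<longleftrightarrow>
     free_process x0 y0 T x y u \<and> (\<forall>t\<in>{0..T}. y t \<ge> - q * x t - b)"

definition free_optimal ::
  "real \<Rightarrow> real \<Rightarrow> real \<Rightarrow> (real \<Rightarrow> real) \<Rightarrow> (real \<Rightarrow> real) \<Rightarrow> (real \<Rightarrow> real) \<Rightarrow> bool" where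
  "free_optimal x0 y0 T x y u \<longleftrightarrow>
     free_process x0 y0 T x y u \<and>
     (\<forall>T' x' y' u'. free_process x0 y0 T' x' y' u' \<longrightarrow> T \<le> T')"

definition constrained_optimal ::
  "real \<Rightarrow> real \<Rightarrow> real \<Rightarrow> real \<Rightarrow> real \<Rightarrow> (real \<Rightarrow> real) \<Rightarrow> (real \<Rightarrow> real) \<Rightarrow> (real \<Rightarrow> real) \<Rightarrow> bool" where
  "constrained_optimal q b x0 y0 T x y u \<longleftrightarrow>
     constrained_process q b x0 y0 T x y u \<and>
     (\<forall>T' x' y' u'. constrained_process q b x0 y0 T' x' y' u' \<longrightarrow> T \<le> T')"

definition boundary_line :: "real \<Rightarrow> real \<Rightarrow> (real \<times> real) set" where
  "boundary_line q b = {(x, y). y = - q * x - b}"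

definition switch_fun :: "real \<Rightarrow> real" where
  "switch_fun y = (if y \<ge> 0 then - (1/2) * y\<^sup>2 else (1/2) * y\<^sup>2)"

definition switching_curve :: "(real \<times> real) set" where
  "switching_curve = {(x, y). x = switch_fun y}"

text \<open>
  The point \<open>C\<close> is the point of tangency of the boundary line with a parabola of the family
  \<open>x = y\<^sup>2 / 2 + const\<close>; \<open>F\<close> is the intersection point of the boundary line with the right
  (lower) branch of the switching curve that lies above \<open>C\<close> (when \<open>2 * b * q < 1\<close>).
\<close>

definition point_C :: "real \<Rightarrow> real \<Rightarrow> real \<times> real" where
  "point_C q b = ((1 - b * q) / q\<^sup>2, - 1 / q)"

definition y_F :: "real \<Rightarrow> real \<Rightarrow> real" where
  "y_F q b = (- 1 + sqrt (1 - 2 * b * q)) / q"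

definition point_F :: "real \<Rightarrow> real \<Rightarrow> real \<times> real" where
  "point_F q b = ((1/2) * (y_F q b)\<^sup>2, y_F q b)"

text \<open>
  The arc from \<open>C\<close> downwards of the parabola through \<open>C\<close> with \<open>u = 1\<close>, and the constant of the
  parabola \<open>x = - y\<^sup>2 / 2 + n\<close> through \<open>C\<close> with \<open>u = - 1\<close>.
\<close>

definition arc_CC'' :: "real \<Rightarrow> real \<Rightarrow> (real \<times> real) set" where
  "arc_CC'' q b = {(x, y). x = (1/2) * y\<^sup>2 + (1 - 2 * b * q) / (2 * q\<^sup>2) \<and> y \<le> - 1 / q}"

definition n_C :: "real \<Rightarrow> real \<Rightarrow> real" where
  "n_C q b = (3 - 2 * b * q) / (2 * q\<^sup>2)"

definition Omega1 :: "real \<Rightarrow> real \<Rightarrow> (real \<times> real) set" where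
  "Omega1 q b = {(x, y). y \<ge> - q * x - b \<and> y \<ge> y_F q b \<and> x \<le> switch_fun y}"

definition Omega2 :: "real \<Rightarrow> real \<Rightarrow> (real \<times> real) set" where
  "Omega2 q b = {(x, y). y \<ge> - q * x - b \<and> y \<ge> y_F q b \<and>
     switch_fun y \<le> x \<and> x \<le> (y_F q b)\<^sup>2 - (1/2) * y\<^sup>2}"

definition Omega3 :: "real \<Rightarrow> real \<Rightarrow> (real \<times> real) set" where
  "Omega3 q b = {(x, y). y \<ge> - q * x - b \<and> y \<ge> - 1 / q \<and> x \<le> n_C q b - (1/2) * y\<^sup>2 \<and>
     (y \<ge> y_F q b \<longrightarrow> x \<ge> (y_F q b)\<^sup>2 - (1/2) * y\<^sup>2)}"

definition Omega4 :: "real \<Rightarrow> real \<Rightarrow> (real \<times> real) set" where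
  "Omega4 q b = {(x, y). y \<ge> - q * x - b \<and>
     (y \<ge> - 1 / q \<and> x \<ge> n_C q b - (1/2) * y\<^sup>2 \<or>
      y \<le> - 1 / q \<and> x \<ge> (1/2) * y\<^sup>2 + (1 - 2 * b * q) / (2 * q\<^sup>2))}"

definition control_on :: "real \<Rightarrow> real \<Rightarrow> (real \<Rightarrow> real) \<Rightarrow> (real \<Rightarrow> real) \<Rightarrow> bool" where
  "control_on s t u v \<longleftrightarrow> (AE r in lebesgue_on {s..t}. u r = v r)"

definition two_leg_control :: "real \<Rightarrow> (real \<Rightarrow> real) \<Rightarrow> real \<Rightarrow> real \<Rightarrow> bool" where
  "two_leg_control T u c1 c2 \<longleftrightarrow>
     (\<exists>t1\<in>{0..T}. control_on 0 t1 u (\<lambda>_. c1) \<and> control_on t1 T u (\<lambda>_. c2))"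

text \<open>
  Motion on the time interval \<open>[s, t]\<close> along the segment between \<open>C\<close> and \<open>F\<close> of the boundary line,
  leftwards and upwards, ending at \<open>F\<close>. On the boundary line \<open>y = - q * x - b\<close> the dynamics force
  the control \<open>u = - q * y\<close>.
\<close>

definition boundary_leg_to_F ::
  "real \<Rightarrow> real \<Rightarrow> real \<Rightarrow> real \<Rightarrow> (real \<Rightarrow> real) \<Rightarrow> (real \<Rightarrow> real) \<Rightarrow> (real \<Rightarrow> real) \<Rightarrow> bool" where
  "boundary_leg_to_F q b s t x y u \<longleftrightarrow>
     (\<forall>r\<in>{s..t}. (x r, y r) \<in> closed_segment (point_F q b) (point_C q b)) \<and>
     strict_antimono_on {s..t} x \<and> strict_mono_on {s..t} y \<and>
     control_on s t u (\<lambda>r. - q * y r) \<and>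
     (x t, y t) = point_F q b"

definition synthesis3 ::
  "real \<Rightarrow> real \<Rightarrow> real \<Rightarrow> (real \<Rightarrow> real) \<Rightarrow> (real \<Rightarrow> real) \<Rightarrow> (real \<Rightarrow> real) \<Rightarrow> bool" where
  "synthesis3 q b T x y u \<longleftrightarrow>
     (\<exists>t1 t2. 0 \<le> t1 \<and> t1 \<le> t2 \<and> t2 \<le> T \<and>
        control_on 0 t1 u (\<lambda>_. - 1) \<and>
        boundary_leg_to_F q b t1 t2 x y u \<and>
        control_on t2 T u (\<lambda>_. 1))"

definition synthesis4 ::
  "real \<Rightarrow> real \<Rightarrow> real \<Rightarrow> (real \<Rightarrow> real) \<Rightarrow> (real \<Rightarrow> real) \<Rightarrow> (real \<Rightarrow> real) \<Rightarrow> bool" where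
  "synthesis4 q b T x y u \<longleftrightarrow>
     (\<exists>t1 t2 t3. 0 \<le> t1 \<and> t1 \<le> t2 \<and> t2 \<le> t3 \<and> t3 \<le> T \<and>
        control_on 0 t1 u (\<lambda>_. - 1) \<and>
        (\<forall>r\<in>{t1..t2}. (x r, y r) \<in> arc_CC'' q b) \<and>
        control_on t1 t2 u (\<lambda>_. 1) \<and>
        (x t2, y t2) = point_C q b \<and>
        boundary_leg_to_F q b t2 t3 x y u \<and>
        control_on t3 T u (\<lambda>_. 1))"

end

theory Submission imports Defs begin

text \<open>
  The system is linear and the state constraint is convex, so the conditions of the maximum principle
  are sufficient, and the adjoint vector is a certificate of optimality and of uniqueness. Let
  \<open>(x', y')\<close> be the proposed trajectory on \<open>[0, T]\<close>. A process that is not longer can be prolonged to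
  \<open>[0, T]\<close> by resting at the origin (\<open>trajectory_rest_at_origin\<close>). Its deviation from the proposed
  trajectory, paired with the adjoint vector, is a nonincreasing function of time: on arcs with
  control \<open>\<plusminus>1\<close> because the proposed control maximizes the Hamiltonian (\<open>bang_bang_comparison\<close>), on the
  boundary arc because the competitor satisfies the constraint that the proposed trajectory satisfies
  with equality (\<open>boundary_arc_comparison\<close>), and at the time of arrival at the boundary arc because the
  jump of the adjoint vector is a nonpositive multiple of the gradient of the constraint
  (\<open>constrained_trajectory_unique\<close>). As the deviation vanishes at both ends, the pairing vanishes
  identically, and this forces the deviation to vanish. The competitor is therefore the proposed
  trajectory, which does not rest before the time \<open>T\<close>, so the competitor is not shorter
  (\<open>not_longer_process_eq\<close>). In the free problem the same argument needs one adjoint vector without a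
  jump (\<open>free_trajectory_unique\<close>).

  The measurable control enters in two places only. A process has a 1-Lipschitz \<open>y\<close> and an everywhere
  differentiable \<open>x\<close> (\<open>free_process_imp_trajectory\<close>), because a Lipschitz function with an almost
  everywhere nonnegative derivative is nondecreasing (\<open>lipschitz_deriv_nonneg_imp_mono\<close>). And the
  trajectory determines the control almost everywhere (\<open>process_control_on\<close>).

  It remains to construct the proposed trajectories and to check that they respect the constraint
  (\<open>free_candidate\<close>, \<open>constrained_candidate\<close>). The synthesis on \<open>\<Omega>\<^sub>3\<close> is the case of the one on \<open>\<Omega>\<^sub>4\<close> in
  which the leg along the arc below \<open>C\<close> is a point, except that the boundary arc may then start
  anywhere between \<open>C\<close> and \<open>F\<close>; both are instances of \<open>constrained_synthesis\<close>.
\<close>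

section \<open>Lipschitz functions with an almost everywhere given derivative\<close>

lemma AE_lebesgue_on_interval_iff:
  fixes a b :: real
  shows "(AE t in lebesgue_on {a..b}. P t) \<longleftrightarrow> negligible {t\<in>{a..b}. \<not> P t}"
proof -
  have "(AE t in lebesgue_on {a..b}. P t) \<longleftrightarrow> (AE t in lebesgue. t \<in> {a..b} \<longrightarrow> P t)"
    by (rule AE_restrict_space_iff) auto
  also have "\<dots> \<longleftrightarrow> (\<exists>N\<in>null_sets lebesgue. {t\<in>{a..b}. \<not> P t} \<subseteq> N)"
    by (auto simp: eventually_ae_filter)
  also have "\<dots> \<longleftrightarrow> negligible {t\<in>{a..b}. \<not> P t}"
    using negligible_iff_null_sets negligible_subset by blast
  finally show ?thesis .
qed

text \<open>
  A Lipschitz function maps null sets to null sets. After a tilt that makes the derivative positive,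
  some intermediate value is therefore attained only at points of differentiability, and at the last
  point where it is attained the positive derivative is contradictory.
\<close>

lemma lipschitz_deriv_nonneg_imp_mono:
  fixes f :: "real \<Rightarrow> real"
  assumes lip: "L-lipschitz_on {a..b} f" and N: "negligible N"
    and der: "\<And>t. t \<in> {a..b} - N \<Longrightarrow> \<exists>d\<ge>0. (f has_real_derivative d) (at t within {a..b})"
    and st: "a \<le> s" "s \<le> t" "t \<le> b"
  shows "f s \<le> f t"
proof (rule ccontr)
  assume "\<not> f s \<le> f t"
  then have less: "f t < f s" by simp
  then have "s < t" using st by (cases "s = t") auto
  define e where "e = (f s - f t) / (2 * (t - s))"
  have e: "e > 0" using less \<open>s < t\<close> by (simp add: e_def)
  define g where "g r = f r + e * (r - s)" for r
  have gs: "g s = f s" by (simp add: g_def)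
  have "e * (t - s) = (f s - f t) / 2"
    using \<open>s < t\<close> by (simp add: e_def divide_simps)
  then have gt: "g t = f t + (f s - f t) / 2"
    by (simp add: g_def)
  have "g t < g s" using less by (simp add: gs gt field_simps)
  have glip: "\<bar>g r - g r'\<bar> \<le> (L + e) * \<bar>r - r'\<bar>" if "r \<in> {a..b}" "r' \<in> {a..b}" for r r'
  proof -
    have "\<bar>f r - f r'\<bar> \<le> L * \<bar>r - r'\<bar>"
      using lipschitz_onD[OF lip that] by (simp add: dist_real_def)
    moreover have "g r - g r' = (f r - f r') + e * (r - r')" by (simp add: g_def algebra_simps)
    moreover have "\<bar>e * (r - r')\<bar> = e * \<bar>r - r'\<bar>" using e by (simp add: abs_mult)
    ultimately show ?thesis
      using abs_triangle_ineq[of "f r - f r'" "e * (r - r')"] by (simp add: distrib_right)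
  qed
  have "negligible (g ` (N \<inter> {a..b}))"
  proof (rule negligible_locally_Lipschitz_image)
    show "negligible (N \<inter> {a..b})" using N by (rule negligible_subset) auto
    fix r assume "r \<in> N \<inter> {a..b}"
    then show "\<exists>T B. open T \<and> r \<in> T \<and> (\<forall>r'\<in>N \<inter> {a..b} \<inter> T. norm (g r' - g r) \<le> B * norm (r' - r))"
      using glip by (intro exI[of _ UNIV] exI[of _ "L + e"]) auto
  qed simp
  moreover have "\<not> negligible {g t<..<g s}"
    using \<open>g t < g s\<close> by (intro open_not_negligible) auto
  ultimately obtain c where c: "g t < c" "c < g s" "c \<notin> g ` (N \<inter> {a..b})"
    by (meson greaterThanLessThan_iff negligible_subset subsetI)
  have contg: "continuous_on {s..t} g"
  proof -
    have "continuous_on {s..t} f"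
      using lipschitz_on_continuous_on[OF lip] st by (rule_tac continuous_on_subset) auto
    then show ?thesis unfolding g_def by (intro continuous_intros)
  qed
  define R where "R = {r\<in>{s..t}. c \<le> g r}"
  have "closed R" unfolding R_def
    using continuous_closed_preimage[OF contg, of "{c..}"] by (simp add: vimage_def Int_def conj_commute)
  moreover have "bounded R"
    by (rule bounded_subset[of "{s..t}"]) (auto simp: R_def)
  moreover have "s \<in> R" using c \<open>s < t\<close> by (simp add: R_def)
  ultimately obtain r where r: "r \<in> R" "\<And>r'. r' \<in> R \<Longrightarrow> r' \<le> r"
    using compact_attains_sup[of R] compact_eq_bounded_closed by blast
  have "r < t" using r(1) c by (cases "r = t") (auto simp: R_def)
  have "g r = c"
  proof (rule ccontr)
    assume "g r \<noteq> c"
    then have "c < g r" using r by (auto simp: R_def)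
    have "continuous_on {r..t} g"
      using contg r(1) by (rule_tac continuous_on_subset) (auto simp: R_def)
    then obtain r' where "r \<le> r'" "r' \<le> t" "g r' = c"
      using IVT2'[of g t c r] c \<open>c < g r\<close> \<open>r < t\<close> by auto
    then have "r' \<in> R" using r by (auto simp: R_def)
    then have "r' = r" using r(2) \<open>r \<le> r'\<close> by force
    then show False using \<open>g r' = c\<close> \<open>g r \<noteq> c\<close> by simp
  qed
  then have "r \<in> {a..b} - N" using c(3) r(1) st by (auto simp: R_def)
  then obtain d where d: "d \<ge> 0" "(f has_real_derivative d) (at r within {a..b})"
    using der by blast
  have "(g has_real_derivative d + e) (at r within {a..b})"
    unfolding g_def by (auto intro!: derivative_eq_intros d(2))
  then obtain h0 where h0: "h0 > 0"
    "\<And>h. h > 0 \<Longrightarrow> r + h \<in> {a..b} \<Longrightarrow> h < h0 \<Longrightarrow> g r < g (r + h)"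
    using has_real_derivative_pos_inc_right[of g "d + e" r "{a..b}"] d(1) e by auto
  define h where "h = min (h0 / 2) (t - r)"
  have h: "h > 0" "h < h0" "r + h \<le> t" using h0(1) \<open>r < t\<close> by (auto simp: h_def)
  moreover have "s \<le> r" using r(1) by (simp add: R_def)
  ultimately have "g r < g (r + h)" using h0(2) st by auto
  then have "r + h \<in> R" using h \<open>g r = c\<close> \<open>s \<le> r\<close> by (simp add: R_def)
  then show False using r(2) h(1) by force
qed

lemma lipschitz_deriv_zero_imp_const:
  fixes f :: "real \<Rightarrow> real"
  assumes lip: "L-lipschitz_on {a..b} f" and N: "negligible N"
    and der: "\<And>t. t \<in> {a..b} - N \<Longrightarrow> (f has_real_derivative 0) (at t within {a..b})"
    and t: "t \<in> {a..b}"
  shows "f t = f a"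
proof (rule antisym)
  show "f a \<le> f t"
    by (rule lipschitz_deriv_nonneg_imp_mono[OF lip N]) (use der t in auto)
  have "- f a \<le> - f t"
    by (rule lipschitz_deriv_nonneg_imp_mono[of L a b "\<lambda>t. - f t", OF _ N])
       (use lip der t in \<open>auto intro!: derivative_eq_intros exI[of _ 0]\<close>)
  then show "f t \<le> f a" by simp
qed

lemma continuous_deriv_imp_lipschitz:
  fixes f :: "real \<Rightarrow> real"
  assumes der: "\<And>t. t \<in> {a..b} \<Longrightarrow> (f has_real_derivative f' t) (at t within {a..b})"
    and cont: "continuous_on {a..b} f'"
  shows "\<exists>L. L-lipschitz_on {a..b} f"
proof -
  have "bounded (f' ` {a..b})"
    using compact_continuous_image[OF cont] compact_imp_bounded by blast
  then obtain B where B: "B > 0" "\<And>t. t \<in> {a..b} \<Longrightarrow> \<bar>f' t\<bar> \<le> B"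
    unfolding bounded_pos by auto
  have "B-lipschitz_on {a..b} f"
  proof (rule lipschitz_onI)
    fix s t assume st: "s \<in> {a..b}" "t \<in> {a..b}"
    have "norm (f t - f s) \<le> B * norm (t - s)"
      by (rule field_differentiable_bound[of "{a..b}" f f' B]) (use der B st in auto)
    then show "dist (f s) (f t) \<le> B * dist s t"
      by (simp add: dist_real_def abs_minus_commute)
  qed (use B in auto)
  then show ?thesis by blast
qed

section \<open>Trajectories of the double integrator\<close>

text \<open>
  The control is eliminated: the condition \<open>\<bar>u\<bar> \<le> 1\<close> becomes the Lipschitz condition with constant 1
  on \<open>y\<close>, and \<open>x\<close>, whose almost everywhere derivative is the continuous function \<open>y\<close>, has this
  derivative at every point.
\<close>

definition trajectory :: "real \<Rightarrow> real \<Rightarrow> (real \<Rightarrow> real) \<Rightarrow> (real \<Rightarrow> real) \<Rightarrow> bool" where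
  "trajectory a b x y \<longleftrightarrow>
     1-lipschitz_on {a..b} y \<and> (\<forall>t\<in>{a..b}. (x has_real_derivative y t) (at t within {a..b}))"

lemma trajectory_subset:
  assumes "trajectory a b x y" "a \<le> c" "d \<le> b"
  shows "trajectory c d x y"
proof -
  have "{c..d} \<subseteq> {a..b}" using assms by auto
  then show ?thesis
    using assms(1) unfolding trajectory_def
    by (meson has_field_derivative_subset lipschitz_on_subset subsetD)
qed

lemma trajectory_lipschitzD:
  assumes "trajectory a b x y" "s \<in> {a..b}" "t \<in> {a..b}"
  shows "\<bar>y t - y s\<bar> \<le> \<bar>t - s\<bar>"
  using assms lipschitz_onD[of 1 "{a..b}" y t s] by (simp add: trajectory_def dist_real_def)

lemma trajectory_continuous_on:
  "trajectory a b x y \<Longrightarrow> continuous_on {a..b} x \<and> continuous_on {a..b} y"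
  unfolding trajectory_def
  by (meson DERIV_continuous continuous_on_eq_continuous_within lipschitz_on_continuous_on)

lemma free_process_imp_trajectory:
  assumes "free_process x0 y0 T x y u"
  shows "trajectory 0 T x y"
proof -
  define N where "N = {t\<in>{0..T}. \<not> \<bar>u t\<bar> \<le> 1} \<union>
    {t\<in>{0..T}. \<not> (x has_real_derivative y t) (at t within {0..T})} \<union>
    {t\<in>{0..T}. \<not> (y has_real_derivative u t) (at t within {0..T})}"
  have N: "negligible N"
    using assms unfolding free_process_def AE_lebesgue_on_interval_iff N_def by auto
  obtain L M where L: "L-lipschitz_on {0..T} x" and M: "M-lipschitz_on {0..T} y"
    using assms unfolding free_process_def by auto
  have dx: "(x has_real_derivative y t) (at t within {0..T})"
    and dy: "(y has_real_derivative u t) (at t within {0..T})"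
    and u: "\<bar>u t\<bar> \<le> 1" if "t \<in> {0..T} - N" for t
    using that by (auto simp: N_def)
  have y_up: "s - y s \<le> t - y t" and y_down: "s + y s \<le> t + y t"
    if "0 \<le> s" "s \<le> t" "t \<le> T" for s t
  proof -
    show "s - y s \<le> t - y t"
    proof (rule lipschitz_deriv_nonneg_imp_mono[OF _ N _ that])
      show "(1 + M)-lipschitz_on {0..T} (\<lambda>t. t - y t)" by (intro lipschitz_intros M)
      fix t assume "t \<in> {0..T} - N"
      then show "\<exists>d\<ge>0. ((\<lambda>t. t - y t) has_real_derivative d) (at t within {0..T})"
        using dy[of t] u[of t] by (intro exI[of _ "1 - u t"]) (auto intro!: derivative_eq_intros)
    qed
    show "s + y s \<le> t + y t"
    proof (rule lipschitz_deriv_nonneg_imp_mono[OF _ N _ that])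
      show "(1 + M)-lipschitz_on {0..T} (\<lambda>t. t + y t)" by (intro lipschitz_intros M)
      fix t assume "t \<in> {0..T} - N"
      then show "\<exists>d\<ge>0. ((\<lambda>t. t + y t) has_real_derivative d) (at t within {0..T})"
        using dy[of t] u[of t] by (intro exI[of _ "1 + u t"]) (auto intro!: derivative_eq_intros)
    qed
  qed
  have y: "1-lipschitz_on {0..T} y"
  proof (rule lipschitz_onI)
    fix s t assume "s \<in> {0..T}" "t \<in> {0..T}"
    then show "dist (y s) (y t) \<le> 1 * dist s t"
      using y_up[of s t] y_down[of s t] y_up[of t s] y_down[of t s]
      by (cases "s \<le> t") (auto simp: dist_real_def)
  qed simp
  then have cont: "continuous_on {0..T} y" by (rule lipschitz_on_continuous_on)
  define G where "G t = integral {0..t} y" for t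
  have G: "(G has_real_derivative y t) (at t within {0..T})" if "t \<in> {0..T}" for t
    unfolding G_def by (rule integral_has_real_derivative[OF cont that])
  then obtain K where K: "K-lipschitz_on {0..T} G"
    using continuous_deriv_imp_lipschitz[OF _ cont, of G] by blast
  have xG: "x t - G t = x 0 - G 0" if "t \<in> {0..T}" for t
  proof (rule lipschitz_deriv_zero_imp_const[OF _ N _ that])
    show "(L + K)-lipschitz_on {0..T} (\<lambda>t. x t - G t)" by (intro lipschitz_intros L K)
    fix t assume "t \<in> {0..T} - N"
    then show "((\<lambda>t. x t - G t) has_real_derivative 0) (at t within {0..T})"
      using dx[of t] G[of t] by (auto intro!: derivative_eq_intros)
  qed
  have "(x has_real_derivative y t) (at t within {0..T})" if t: "t \<in> {0..T}" for t
  proof -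
    have "((\<lambda>t. G t + (x 0 - G 0)) has_real_derivative y t) (at t within {0..T})"
      using G[OF t] by (auto intro!: derivative_eq_intros)
    then show ?thesis
      by (rule has_field_derivative_transform_within[of _ _ _ _ 1]) (use t xG in \<open>auto simp: algebra_simps\<close>)
  qed
  with y show ?thesis by (auto simp: trajectory_def)
qed

text \<open>Once at the origin, a trajectory may rest there.\<close>

lemma trajectory_rest_at_origin:
  assumes tr: "trajectory 0 T' x y" and "0 \<le> T'" "T' \<le> T" and "x T' = 0" "y T' = 0"
  shows "trajectory 0 T (\<lambda>t. x (min t T')) (\<lambda>t. y (min t T'))"
  unfolding trajectory_def
proof (intro conjI ballI)
  show "1-lipschitz_on {0..T} (\<lambda>t. y (min t T'))"
  proof (rule lipschitz_onI)
    fix s t assume "s \<in> {0..T}" "t \<in> {0..T}"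
    then have "\<bar>y (min s T') - y (min t T')\<bar> \<le> \<bar>min s T' - min t T'\<bar>"
      using assms by (intro trajectory_lipschitzD[OF tr]) auto
    also have "\<dots> \<le> \<bar>s - t\<bar>" by (auto simp: min_def)
    finally show "dist (y (min s T')) (y (min t T')) \<le> 1 * dist s t"
      by (simp add: dist_real_def)
  qed simp
  fix t assume t: "t \<in> {0..T}"
  have dx: "(x has_real_derivative y r) (at r within {0..T'})" if "r \<in> {0..T'}" for r
    using tr that by (simp add: trajectory_def)
  let ?X = "\<lambda>t. x (min t T')" and ?Y = "\<lambda>t. y (min t T')"
  have left: "(?X has_real_derivative ?Y t) (at t within {0..T'})" if "t \<le> T'"
    by (rule has_field_derivative_transform_within[of x _ _ _ 1])
       (use dx[of t] t that in auto)
  have right: "(?X has_real_derivative ?Y t) (at t within {T'..T})" if "T' \<le> t"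
    by (rule has_field_derivative_transform_within[of "\<lambda>_. 0" _ _ _ 1])
       (use t that assms in auto)
  have split: "{0..T} = {0..T'} \<union> {T'..T}" using assms by auto
  consider "t < T'" | "t = T'" | "T' < t" by linarith
  then show "(?X has_real_derivative ?Y t) (at t within {0..T})"
  proof cases
    case 1
    then have "at t within {0..T} = at t within {0..T'}"
      using assms(3) by (intro at_within_nhd[of _ "{..<T'}"]) auto
    then show ?thesis using left 1 by simp
  next
    case 2
    then show ?thesis
      using left right unfolding has_field_derivative_iff split by (intro Lim_Un) auto
  next
    case 3
    then have "at t within {0..T} = at t within {T'..T}"
      using assms(2) by (intro at_within_nhd[of _ "{T'<..}"]) auto
    then show ?thesis using right 3 by simp
  qed
qed

section \<open>Comparison of trajectories\<close>

text \<open>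
  The function \<open>D\<close> is the pairing of the deviation from the reference trajectory \<open>(x', y')\<close> with the
  adjoint vector \<open>(- \<sigma>, \<sigma> * (t - \<tau>))\<close>, whose second component has the sign of the reference control.
  Its derivative is \<open>\<sigma> * (t - \<tau>)\<close> times the difference of the controls, hence not positive. The proof
  uses the mean value theorem instead, because \<open>y\<close> is only Lipschitz.
\<close>

lemma bang_bang_comparison:
  fixes \<sigma> \<tau> c :: real
  assumes tr: "trajectory a b x y" and tr': "trajectory a b x' y'"
    and \<sigma>: "\<sigma> = 1 \<or> \<sigma> = - 1" and \<tau>: "\<tau> \<in> {a..b}"
    and y': "\<And>t. t \<in> {a..b} \<Longrightarrow> y' t = c + \<sigma> * \<bar>t - \<tau>\<bar>"
  defines "D \<equiv> \<lambda>t. \<sigma> * ((t - \<tau>) * (y t - y' t) - (x t - x' t))"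
  shows bang_bang_antimono: "D b \<le> D a"
    and bang_bang_unique: "D a = 0 \<Longrightarrow> D b = 0 \<Longrightarrow> y a = y' a \<or> y b = y' b \<Longrightarrow>
      t \<in> {a..b} \<Longrightarrow> x t = x' t \<and> y t = y' t"
proof -
  define dy where "dy t = \<sigma> * (y t - y' t)" for t
  define dx where "dx t = \<sigma> * (x t - x' t)" for t
  have D: "D t = (t - \<tau>) * dy t - dx t" for t
    unfolding D_def dy_def dx_def by (simp add: algebra_simps)
  have dy_right: "dy t \<le> dy s" if "\<tau> \<le> s" "s \<le> t" "t \<le> b" for s t
    using trajectory_lipschitzD[OF tr, of s t] \<sigma> \<tau> that y'[of s] y'[of t]
    by (auto simp: dy_def)
  have dy_left: "dy s \<le> dy t" if "a \<le> s" "s \<le> t" "t \<le> \<tau>" for s t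
    using trajectory_lipschitzD[OF tr, of s t] \<sigma> \<tau> that y'[of s] y'[of t]
    by (auto simp: dy_def)
  have mvt: "\<exists>r\<in>{s<..<t}. dx t - dx s = (t - s) * dy r" if "a \<le> s" "s < t" "t \<le> b" for s t
  proof -
    have "(dx has_real_derivative dy r) (at r within {s..t})" if "r \<in> {s..t}" for r
      using trajectory_subset[OF tr \<open>a \<le> s\<close> \<open>t \<le> b\<close>] trajectory_subset[OF tr' \<open>a \<le> s\<close> \<open>t \<le> b\<close>] that
      unfolding dx_def dy_def trajectory_def by (auto intro!: derivative_eq_intros)
    then have "\<exists>r\<in>{s<..<t}. dx t - dx s = (*) (dy r) (t - s)"
      using \<open>s < t\<close> by (intro mvt_simple) (auto simp: has_field_derivative_def)
    then show ?thesis by (simp add: mult.commute)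
  qed
  have D_right: "(s - \<tau>) * (dy s - dy t) \<le> D s - D t" if "\<tau> \<le> s" "s \<le> t" "t \<le> b" for s t
  proof (cases "s = t")
    case False
    with that \<tau> have "a \<le> s" "s < t" "t \<le> b" by auto
    from mvt[OF this] obtain r where r: "r \<in> {s<..<t}" "dx t - dx s = (t - s) * dy r"
      by blast
    then have "(t - s) * dy t \<le> (t - s) * dy r"
      using dy_right[of r t] that by (intro mult_left_mono) auto
    then show ?thesis using r(2) unfolding D by (simp add: algebra_simps)
  qed simp
  have D_left: "(\<tau> - t) * (dy t - dy s) \<le> D s - D t" if "a \<le> s" "s \<le> t" "t \<le> \<tau>" for s t
  proof (cases "s = t")
    case False
    with that \<tau> have "a \<le> s" "s < t" "t \<le> b" by auto
    from mvt[OF this] obtain r where r: "r \<in> {s<..<t}" "dx t - dx s = (t - s) * dy r"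
      by blast
    then have "(t - s) * dy s \<le> (t - s) * dy r"
      using dy_left[of s r] that by (intro mult_left_mono) auto
    then show ?thesis using r(2) unfolding D by (simp add: algebra_simps)
  qed simp
  have mono: "D t \<le> D s" if "a \<le> s" "s \<le> t" "t \<le> b" for s t
  proof -
    have right: "D t \<le> D s" if "\<tau> \<le> s" "s \<le> t" "t \<le> b" for s t
    proof -
      have "0 \<le> (s - \<tau>) * (dy s - dy t)"
        using dy_right[OF that] that by (intro mult_nonneg_nonneg) auto
      then show ?thesis using D_right[OF that] by linarith
    qed
    have left: "D t \<le> D s" if "a \<le> s" "s \<le> t" "t \<le> \<tau>" for s t
    proof -
      have "0 \<le> (\<tau> - t) * (dy t - dy s)"
        using dy_left[OF that] that by (intro mult_nonneg_nonneg) auto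
      then show ?thesis using D_left[OF that] by linarith
    qed
    show ?thesis
      using left[of s t] right[of s t] left[of s \<tau>] right[of \<tau> t] that by linarith
  qed
  show "D b \<le> D a" using mono[of a b] \<tau> by auto
  assume D0: "D a = 0" "D b = 0" and end0: "y a = y' a \<or> y b = y' b" and t: "t \<in> {a..b}"
  have zero: "D s = 0" if "s \<in> {a..b}" for s
    using mono[of a s] mono[of s b] D0 that by auto
  have cont: "continuous_on {a..b} dy"
    unfolding dy_def using trajectory_continuous_on[OF tr] trajectory_continuous_on[OF tr']
    by (intro continuous_intros) auto
  have right: "dy s = dy b" if "\<tau> < s" "s \<le> b" for s
  proof -
    have "(s - \<tau>) * (dy s - dy b) \<le> 0" using D_right[of s b] that zero[of s] zero[of b] \<tau> by auto
    then have "dy s \<le> dy b" using that by (simp add: mult_le_0_iff)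
    then show ?thesis using dy_right[of s b] that by auto
  qed
  have left: "dy s = dy a" if "s < \<tau>" "a \<le> s" for s
  proof -
    have "(\<tau> - s) * (dy s - dy a) \<le> 0" using D_left[of a s] that zero[of s] zero[of a] \<tau> by auto
    then have "dy s \<le> dy a" using that by (simp add: mult_le_0_iff)
    then show ?thesis using dy_left[of a s] that by auto
  qed
  have "dy \<tau> = dy b"
  proof (cases "\<tau> < b")
    case True
    then have cl: "closure {\<tau><..<b} = {\<tau>..b}" by simp
    show ?thesis
    proof (rule continuous_constant_on_closure[where f = dy])
      show "continuous_on (closure {\<tau><..<b}) dy"
        unfolding cl using cont \<tau> by (rule_tac continuous_on_subset) auto
      show "\<tau> \<in> closure {\<tau><..<b}" unfolding cl using True by simp
      show "dy s = dy b" if "s \<in> {\<tau><..<b}" for s using right[of s] that by simp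
    qed
  qed (use \<tau> in auto)
  moreover have "dy \<tau> = dy a"
  proof (cases "a < \<tau>")
    case True
    then have cl: "closure {a<..<\<tau>} = {a..\<tau>}" by simp
    show ?thesis
    proof (rule continuous_constant_on_closure[where f = dy])
      show "continuous_on (closure {a<..<\<tau>}) dy"
        unfolding cl using cont \<tau> by (rule_tac continuous_on_subset) auto
      show "\<tau> \<in> closure {a<..<\<tau>}" unfolding cl using True by simp
      show "dy s = dy a" if "s \<in> {a<..<\<tau>}" for s using left[of s] that by simp
    qed
  qed (use \<tau> in auto)
  moreover have "dy a = 0 \<or> dy b = 0" using end0 by (auto simp: dy_def)
  ultimately have "dy t = 0"
    using left[of t] right[of t] t by (cases t \<tau> rule: linorder_cases) auto
  moreover from this have "dx t = 0" using zero[OF t] by (simp add: D)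
  ultimately show "x t = x' t \<and> y t = y' t" using \<sigma> by (auto simp: dx_def dy_def)
qed

text \<open>
  On a boundary arc of the reference trajectory the state constraint says that the derivative of the
  deviation of \<open>x\<close>, weighted by an exponential, is nonnegative.
\<close>

lemma boundary_arc_comparison:
  fixes q \<beta> :: real
  assumes tr: "trajectory a b x y" and tr': "trajectory a b x' y'" and "a \<le> b"
    and y': "\<And>t. t \<in> {a..b} \<Longrightarrow> y' t = - q * x' t - \<beta>"
    and y: "\<And>t. t \<in> {a..b} \<Longrightarrow> y t \<ge> - q * x t - \<beta>"
  shows boundary_arc_mono: "exp (q * a) * (x a - x' a) \<le> exp (q * b) * (x b - x' b)"
    and boundary_arc_unique: "x a = x' a \<Longrightarrow> x b = x' b \<Longrightarrow> y b = y' b \<Longrightarrow>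
      t \<in> {a..b} \<Longrightarrow> x t = x' t \<and> y t = y' t"
proof -
  define E where "E t = exp (q * t) * (x t - x' t)" for t
  have mono: "E s \<le> E t" if "a \<le> s" "s \<le> t" "t \<le> b" for s t
  proof (rule DERIV_nonneg_imp_increasing_open[OF \<open>s \<le> t\<close>])
    have "continuous_on {s..t} x" "continuous_on {s..t} x'"
      using trajectory_continuous_on trajectory_subset tr tr' that by blast+
    then show "continuous_on {s..t} E" unfolding E_def by (intro continuous_intros)
    fix r assume r: "s < r" "r < t"
    then have "at r within {a..b} = at r" using that by (intro at_within_Icc_at) auto
    then have "(x has_real_derivative y r) (at r)" "(x' has_real_derivative y' r) (at r)"
      using tr tr' r that unfolding trajectory_def by (metis atLeastAtMost_iff less_le order_trans)+
    then have "(E has_real_derivative exp (q * r) * (q * (x r - x' r) + (y r - y' r))) (at r)"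
      unfolding E_def by (auto intro!: derivative_eq_intros simp: algebra_simps)
    moreover have "0 \<le> exp (q * r) * (q * (x r - x' r) + (y r - y' r))"
      using y[of r] y'[of r] r that by (intro mult_nonneg_nonneg) (auto simp: algebra_simps)
    ultimately show "\<exists>d. (E has_real_derivative d) (at r) \<and> 0 \<le> d" by blast
  qed
  then show "exp (q * a) * (x a - x' a) \<le> exp (q * b) * (x b - x' b)"
    using \<open>a \<le> b\<close> by (simp add: E_def)
  assume ends: "x a = x' a" "x b = x' b" "y b = y' b" and t: "t \<in> {a..b}"
  have x: "x s = x' s" if "s \<in> {a..b}" for s
    using mono[of a s] mono[of s b] ends that by (auto simp: E_def mult_le_0_iff zero_le_mult_iff)
  show "x t = x' t \<and> y t = y' t"
  proof (cases "a < b")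
    case True
    have "(x has_vector_derivative y t) (at t within {a..b})"
      using tr t by (auto simp: trajectory_def has_real_derivative_iff_has_vector_derivative)
    moreover have "(x has_real_derivative y' t) (at t within {a..b})"
      by (rule has_field_derivative_transform_within[of x' _ _ _ 1])
         (use tr' t x in \<open>auto simp: trajectory_def\<close>)
    then have "(x has_vector_derivative y' t) (at t within {a..b})"
      by (simp add: has_real_derivative_iff_has_vector_derivative)
    ultimately have "y t = y' t"
      using vector_derivative_unique_within_closed_interval[of a b t x] True t by simp
    then show ?thesis using x t by simp
  next
    case False
    then have "t = b" using t \<open>a \<le> b\<close> by auto
    then show ?thesis using ends by simp
  qed
qed

text \<open>
  The deviation vanishes at both ends of the interval, hence so does its pairing with the adjoint
  vector, and monotonicity leaves no room in between.
\<close>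

lemma free_trajectory_unique:
  fixes \<sigma> \<tau> c :: real
  assumes tr: "trajectory 0 T x y" and tr': "trajectory 0 T x' y'"
    and "\<sigma> = 1 \<or> \<sigma> = - 1" and "\<tau> \<in> {0..T}"
    and "\<And>t. t \<in> {0..T} \<Longrightarrow> y' t = c + \<sigma> * \<bar>t - \<tau>\<bar>"
    and "x 0 = x' 0" "y 0 = y' 0" "x T = x' T" "y T = y' T" and "t \<in> {0..T}"
  shows "x t = x' t \<and> y t = y' t"
  by (rule bang_bang_unique[OF tr tr']) (use assms in auto)

text \<open>
  The adjoint vector is \<open>(- 1, t - t1)\<close> on the first arc, a negative multiple of \<open>(exp (q * t), 0)\<close> on
  the boundary arc, and a positive multiple of \<open>(- 1, t - t3)\<close> on the last arc. At the time \<open>t2\<close> it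
  jumps by \<open>- (t2 - t1)\<close> times the gradient \<open>(q, 1)\<close> of the state constraint. There the reference
  trajectory lies on the boundary, so the deviation has a nonnegative product with the gradient and
  the jump decreases the pairing as well.
\<close>

lemma constrained_trajectory_unique:
  fixes q \<beta> c d t1 t2 t3 T :: real
  assumes q: "0 < q" and tr: "trajectory 0 T x y" and tr': "trajectory 0 T x' y'"
    and times: "0 \<le> t1" "t1 \<le> t2" "t2 \<le> t3" "t3 \<le> T"
    and arc1: "\<And>t. t \<in> {0..t2} \<Longrightarrow> y' t = c + \<bar>t - t1\<bar>"
    and arc2: "\<And>t. t \<in> {t2..t3} \<Longrightarrow> y' t = - q * x' t - \<beta>"
    and arc3: "\<And>t. t \<in> {t3..T} \<Longrightarrow> y' t = d + \<bar>t - t3\<bar>"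
    and y: "\<And>t. t \<in> {0..T} \<Longrightarrow> y t \<ge> - q * x t - \<beta>"
    and ends: "x 0 = x' 0" "y 0 = y' 0" "x T = x' T" "y T = y' T" and t: "t \<in> {0..T}"
  shows "x t = x' t \<and> y t = y' t"
proof -
  have tr1: "trajectory 0 t2 x y" "trajectory 0 t2 x' y'"
    and tr2: "trajectory t2 t3 x y" "trajectory t2 t3 x' y'"
    and tr3: "trajectory t3 T x y" "trajectory t3 T x' y'"
    using trajectory_subset tr tr' times by auto
  have "1 * ((t2 - t1) * (y t2 - y' t2) - (x t2 - x' t2)) \<le>
      1 * ((0 - t1) * (y 0 - y' 0) - (x 0 - x' 0))"
    by (rule bang_bang_antimono[OF tr1, of 1 t1 c]) (use times arc1 in auto)
  then have D1: "(t2 - t1) * (y t2 - y' t2) \<le> x t2 - x' t2" using ends by simp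
  have h2: "- q * (x t2 - x' t2) \<le> y t2 - y' t2"
    using y[of t2] arc2[of t2] times by (simp add: algebra_simps)
  have jump: "(t2 - t1) * (- q * (x t2 - x' t2)) \<le> (t2 - t1) * (y t2 - y' t2)"
    using h2 times by (intro mult_left_mono) auto
  have "0 \<le> (1 + q * (t2 - t1)) * (x t2 - x' t2)"
    using D1 jump by (simp add: algebra_simps)
  moreover have "0 < 1 + q * (t2 - t1)"
    using q times by (intro add_pos_nonneg) auto
  ultimately have x2: "0 \<le> x t2 - x' t2" by (simp add: zero_le_mult_iff)
  have E: "exp (q * t2) * (x t2 - x' t2) \<le> exp (q * t3) * (x t3 - x' t3)"
    by (rule boundary_arc_mono[OF tr2]) (use times arc2 y in auto)
  have "0 \<le> exp (q * t2) * (x t2 - x' t2)" using x2 by simp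
  with E have "0 \<le> exp (q * t3) * (x t3 - x' t3)" by linarith
  then have "0 \<le> x t3 - x' t3" by (simp add: zero_le_mult_iff)
  moreover have "1 * ((T - t3) * (y T - y' T) - (x T - x' T)) \<le>
      1 * ((t3 - t3) * (y t3 - y' t3) - (x t3 - x' t3))"
    by (rule bang_bang_antimono[OF tr3, of 1 t3 d]) (use times arc3 in auto)
  ultimately have x3: "x t3 = x' t3" using ends by simp
  with E x2 have x2': "x t2 = x' t2" by (simp add: mult_le_0_iff)
  have D1': "(t2 - t1) * (y t2 - y' t2) = 0" using D1 jump x2' by simp
  have on1: "x t = x' t \<and> y t = y' t" if "t \<in> {0..t2}" for t
    by (rule bang_bang_unique[OF tr1, of 1 t1 c]) (use times arc1 ends x2' D1' that in auto)
  have on3: "x t = x' t \<and> y t = y' t" if "t \<in> {t3..T}" for t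
    by (rule bang_bang_unique[OF tr3, of 1 t3 d]) (use times arc3 ends x3 that in auto)
  have on2: "x t = x' t \<and> y t = y' t" if "t \<in> {t2..t3}" for t
    by (rule boundary_arc_unique[OF tr2, of q \<beta>]) (use times arc2 y x2' x3 on3[of t3] that in auto)
  show ?thesis using on1[of t] on2[of t] on3[of t] t by force
qed

text \<open>
  Here \<open>P\<close> is the state constraint, or no constraint. A process that is shorter than the
  reference process becomes, by resting at the origin, a competitor on the same interval.
\<close>

lemma not_longer_process_eq:
  assumes pr: "free_process x0 y0 T' x y u" and P: "\<And>t. t \<in> {0..T'} \<Longrightarrow> P (x t) (y t)"
    and P0: "P 0 0" and "T' \<le> T"
    and moving: "\<And>r. 0 \<le> r \<Longrightarrow> r < T \<Longrightarrow> \<exists>t\<in>{r..T}. Y t \<noteq> 0"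
    and unique: "\<And>x y t. trajectory 0 T x y \<Longrightarrow> (\<And>t. t \<in> {0..T} \<Longrightarrow> P (x t) (y t)) \<Longrightarrow>
      x 0 = x0 \<Longrightarrow> y 0 = y0 \<Longrightarrow> x T = 0 \<Longrightarrow> y T = 0 \<Longrightarrow> t \<in> {0..T} \<Longrightarrow> x t = X t \<and> y t = Y t"
  shows "T' = T \<and> (\<forall>t\<in>{0..T}. x t = X t \<and> y t = Y t)"
proof -
  have ends: "0 \<le> T'" "x 0 = x0" "y 0 = y0" "x T' = 0" "y T' = 0"
    using pr by (auto simp: free_process_def)
  have tr: "trajectory 0 T (\<lambda>t. x (min t T')) (\<lambda>t. y (min t T'))"
    using free_process_imp_trajectory[OF pr] ends \<open>T' \<le> T\<close> by (intro trajectory_rest_at_origin)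
  have eq: "x (min t T') = X t \<and> y (min t T') = Y t" if "t \<in> {0..T}" for t
    by (rule unique[OF tr]) (use ends \<open>T' \<le> T\<close> P that in auto)
  have "T' = T"
  proof (rule ccontr)
    assume "T' \<noteq> T"
    then obtain t where "t \<in> {T'..T}" "Y t \<noteq> 0" using moving[of T'] ends \<open>T' \<le> T\<close> by auto
    then show False using eq[of t] ends by (auto simp: min_def split: if_splits)
  qed
  then show ?thesis using eq by (auto simp: min_def)
qed

section \<open>Piecewise smooth processes\<close>

text \<open>
  A steering is a motion on \<open>[a, b]\<close>, without conditions at the ends, that satisfies the equations at
  all times except finitely many. Such motions can be glued. The control is Borel measurable on the
  whole line, and the derivatives are two-sided, which is no restriction since the ends of the
  interval are not considered.
\<close>

definition steering ::
  "real \<Rightarrow> real \<Rightarrow> (real \<Rightarrow> real) \<Rightarrow> (real \<Rightarrow> real) \<Rightarrow> (real \<Rightarrow> real) \<Rightarrow> bool" where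
  "steering a b x y u \<longleftrightarrow>
     a \<le> b \<and> u \<in> borel_measurable borel \<and>
     (\<exists>L. L-lipschitz_on {a..b} x) \<and> (\<exists>L. L-lipschitz_on {a..b} y) \<and>
     (\<exists>N. finite N \<and> (\<forall>t\<in>{a<..<b} - N. \<bar>u t\<bar> \<le> 1 \<and>
        (x has_real_derivative y t) (at t) \<and> (y has_real_derivative u t) (at t)))"

lemma smooth_steering:
  fixes x y u :: "real \<Rightarrow> real"
  assumes "a \<le> b" and cont: "continuous_on UNIV u" and u: "\<And>t. t \<in> {a..b} \<Longrightarrow> \<bar>u t\<bar> \<le> 1"
    and dx: "\<And>t. (x has_real_derivative y t) (at t)"
    and dy: "\<And>t. (y has_real_derivative u t) (at t)"
  shows "steering a b x y u"
proof -
  have dx': "(x has_real_derivative y t) (at t within {a..b})"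
    and dy': "(y has_real_derivative u t) (at t within {a..b})" for t
    using dx dy has_field_derivative_at_within by blast+
  have "continuous_on {a..b} y" using dy by (meson DERIV_isCont continuous_at_imp_continuous_on)
  then obtain L where "L-lipschitz_on {a..b} x"
    using continuous_deriv_imp_lipschitz[OF dx'] by blast
  moreover have "continuous_on {a..b} u" using cont continuous_on_subset by blast
  then obtain M where "M-lipschitz_on {a..b} y"
    using continuous_deriv_imp_lipschitz[OF dy'] by blast
  ultimately show ?thesis
    using assms borel_measurable_continuous_onI[OF cont] unfolding steering_def
    by (auto intro!: exI[of _ "{}"])
qed

lemma steering_append:
  assumes s1: "steering a b x1 y1 u1" and s2: "steering b c x2 y2 u2"
    and match: "x1 b = x2 b" "y1 b = y2 b"
  shows "\<exists>x y u. steering a c x y u \<and>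
    (\<forall>t\<in>{a..b}. x t = x1 t \<and> y t = y1 t \<and> u t = u1 t) \<and>
    (\<forall>t\<in>{b..c}. x t = x2 t \<and> y t = y2 t) \<and> (\<forall>t\<in>{b<..c}. u t = u2 t)"
proof -
  define x where "x t = (if t \<le> b then x1 t else x2 t)" for t
  define y where "y t = (if t \<le> b then y1 t else y2 t)" for t
  define u where "u t = (if t \<le> b then u1 t else u2 t)" for t
  obtain L1 L2 M1 M2 where lip: "L1-lipschitz_on {a..b} x1" "L2-lipschitz_on {b..c} x2"
    "M1-lipschitz_on {a..b} y1" "M2-lipschitz_on {b..c} y2"
    using s1 s2 unfolding steering_def by blast
  have lip_x: "(max L1 L2)-lipschitz_on {a..c} x" unfolding x_def
    using lip match by (intro lipschitz_on_concat) (auto intro: lipschitz_on_le)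
  have lip_y: "(max M1 M2)-lipschitz_on {a..c} y" unfolding y_def
    using lip match by (intro lipschitz_on_concat) (auto intro: lipschitz_on_le)
  have meas: "u \<in> borel_measurable borel"
    unfolding u_def using s1 s2 by (intro measurable_If) (auto simp: steering_def)
  obtain N1 N2 where N: "finite N1" "finite N2"
    and e1: "\<And>t. t \<in> {a<..<b} - N1 \<Longrightarrow> \<bar>u1 t\<bar> \<le> 1 \<and>
      (x1 has_real_derivative y1 t) (at t) \<and> (y1 has_real_derivative u1 t) (at t)"
    and e2: "\<And>t. t \<in> {b<..<c} - N2 \<Longrightarrow> \<bar>u2 t\<bar> \<le> 1 \<and>
      (x2 has_real_derivative y2 t) (at t) \<and> (y2 has_real_derivative u2 t) (at t)"
    using s1 s2 unfolding steering_def by blast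
  have ode: "\<bar>u t\<bar> \<le> 1 \<and> (x has_real_derivative y t) (at t) \<and> (y has_real_derivative u t) (at t)"
    if t: "t \<in> {a<..<c} - (N1 \<union> N2 \<union> {b})" for t
  proof (cases "t < b")
    case True
    have "(x has_real_derivative y1 t) (at t)" "(y has_real_derivative u1 t) (at t)"
      by (rule has_field_derivative_transform_within_open[of _ _ _ "{..<b}"];
          use e1[of t] True t in \<open>auto simp: x_def y_def\<close>)+
    then show ?thesis using True e1[of t] t by (auto simp: y_def u_def)
  next
    case False
    have "(x has_real_derivative y2 t) (at t)" "(y has_real_derivative u2 t) (at t)"
      by (rule has_field_derivative_transform_within_open[of _ _ _ "{b<..}"];
          use e2[of t] False t in \<open>auto simp: x_def y_def\<close>)+
    then show ?thesis using False e2[of t] t by (auto simp: y_def u_def)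
  qed
  have "\<exists>N. finite N \<and> (\<forall>t\<in>{a<..<c} - N. \<bar>u t\<bar> \<le> 1 \<and>
      (x has_real_derivative y t) (at t) \<and> (y has_real_derivative u t) (at t))"
    using N ode by (intro exI[of _ "N1 \<union> N2 \<union> {b}"] conjI ballI) auto
  moreover have "a \<le> c" using s1 s2 by (auto simp: steering_def)
  ultimately have "steering a c x y u"
    unfolding steering_def using lip_x lip_y meas by blast
  moreover have "(\<forall>t\<in>{a..b}. x t = x1 t \<and> y t = y1 t \<and> u t = u1 t) \<and>
    (\<forall>t\<in>{b..c}. x t = x2 t \<and> y t = y2 t) \<and> (\<forall>t\<in>{b<..c}. u t = u2 t)"
    using match by (auto simp: x_def y_def u_def)
  ultimately show ?thesis by blast
qed

lemma steering_imp_free_process: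
  assumes st: "steering 0 T x y u" and ends: "x 0 = x0" "y 0 = y0" "x T = 0" "y T = 0"
  shows "free_process x0 y0 T x y u"
proof -
  obtain N where N: "finite N" "\<And>t. t \<in> {0<..<T} - N \<Longrightarrow> \<bar>u t\<bar> \<le> 1 \<and>
      (x has_real_derivative y t) (at t) \<and> (y has_real_derivative u t) (at t)"
    using st unfolding steering_def by blast
  have ae: "AE t in lebesgue_on {0..T}. P t" if "\<And>t. t \<in> {0<..<T} - N \<Longrightarrow> P t" for P
    unfolding AE_lebesgue_on_interval_iff
  proof (rule negligible_subset)
    show "negligible (N \<union> {0, T})" using N(1) by (intro negligible_finite) simp
    show "{t\<in>{0..T}. \<not> P t} \<subseteq> N \<union> {0, T}"
    proof
      fix t assume "t \<in> {t\<in>{0..T}. \<not> P t}"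
      moreover from this have "t \<notin> {0<..<T} - N" using that[of t] by blast
      ultimately show "t \<in> N \<union> {0, T}" by auto
    qed
  qed
  have "u \<in> borel_measurable (lebesgue_on {0..T})"
    by (intro measurable_restrict_space1 measurable_completion) (use st in \<open>simp add: steering_def\<close>)
  moreover have "AE t in lebesgue_on {0..T}. \<bar>u t\<bar> \<le> 1"
    by (rule ae) (use N(2) in blast)
  moreover have "AE t in lebesgue_on {0..T}. (x has_real_derivative y t) (at t within {0..T})"
    by (rule ae) (use N(2) has_field_derivative_at_within in blast)
  moreover have "AE t in lebesgue_on {0..T}. (y has_real_derivative u t) (at t within {0..T})"
    by (rule ae) (use N(2) has_field_derivative_at_within in blast)
  ultimately show ?thesis
    using st ends unfolding free_process_def steering_def by blast
qed

text \<open>Two processes with the same trajectory have almost everywhere the same control.\<close>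

lemma process_control_on:
  assumes p1: "free_process x0 y0 T x y u" and p2: "free_process x0 y0 T X Y U"
    and eq: "\<And>t. t \<in> {0..T} \<Longrightarrow> y t = Y t"
    and v: "\<And>t. t \<in> {s<..<e} \<Longrightarrow> U t = v t" and se: "0 \<le> s" "e \<le> T"
  shows "control_on s e u v"
proof -
  let ?N1 = "{t\<in>{0..T}. \<not> (y has_real_derivative u t) (at t within {0..T})}"
  let ?N2 = "{t\<in>{0..T}. \<not> (Y has_real_derivative U t) (at t within {0..T})}"
  have "negligible (?N1 \<union> ?N2 \<union> {s, e})"
    using p1 p2 by (auto simp: free_process_def AE_lebesgue_on_interval_iff)
  moreover have "u t = v t" if t: "t \<in> {s..e} - (?N1 \<union> ?N2 \<union> {s, e})" for t
  proof -
    have t0: "t \<in> {0<..<T}" "t \<in> {s<..<e}" using t se by auto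
    then have at: "at t within {0..T} = at t" by (intro at_within_Icc_at) auto
    have "(y has_real_derivative u t) (at t)" "(Y has_real_derivative U t) (at t)"
      using t t0 at by auto
    moreover from this(2) have "(y has_real_derivative U t) (at t)"
      by (rule has_field_derivative_transform_within_open[of _ _ _ "{0<..<T}"]) (use t0 eq in auto)
    ultimately have "u t = U t" by (meson DERIV_unique)
    then show ?thesis using v[OF t0(2)] by simp
  qed
  then have "{t\<in>{s..e}. u t \<noteq> v t} \<subseteq> ?N1 \<union> ?N2 \<union> {s, e}" by blast
  ultimately show ?thesis
    unfolding control_on_def AE_lebesgue_on_interval_iff using negligible_subset by blast
qed

text \<open>Motion with the constant control \<open>\<sigma>\<close> from \<open>(x0, y0)\<close>, starting at time \<open>a\<close>.\<close>

lemma bang_steering: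
  fixes \<sigma> x0 y0 :: real
  assumes "a \<le> b" "\<sigma> = 1 \<or> \<sigma> = - 1"
  shows "steering a b (\<lambda>t. x0 + y0 * (t - a) + \<sigma> * (t - a)\<^sup>2 / 2) (\<lambda>t. y0 + \<sigma> * (t - a)) (\<lambda>_. \<sigma>)"
  by (rule smooth_steering) (use assms in \<open>auto intro!: derivative_eq_intros\<close>)

text \<open>Motion along the boundary line from the point with ordinate \<open>Y\<close>, starting at time \<open>a\<close>.\<close>

lemma boundary_steering:
  fixes q \<beta> Y :: real
  assumes "0 < q" "a \<le> b" "\<bar>q * Y\<bar> \<le> 1"
  shows "steering a b (\<lambda>t. (- Y * exp (- q * (t - a)) - \<beta>) / q) (\<lambda>t. Y * exp (- q * (t - a)))
    (\<lambda>t. - q * (Y * exp (- q * (t - a))))"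
proof (rule smooth_steering)
  fix t assume "t \<in> {a..b}"
  then have "exp (- q * (t - a)) \<le> 1" using assms(1) by simp
  then have "\<bar>q * Y\<bar> * exp (- q * (t - a)) \<le> 1 * 1" using assms by (intro mult_mono) auto
  then show "\<bar>- q * (Y * exp (- q * (t - a)))\<bar> \<le> 1" by (simp add: abs_mult mult.assoc)
qed (use assms in \<open>auto intro!: derivative_eq_intros continuous_intros simp: field_simps\<close>)

section \<open>The switching curve and the boundary line\<close>

lemma boundary_line_Int_switching_curve:
  fixes q b :: real
  assumes "0 < q" "0 < b"
  shows "card (boundary_line q b \<inter> switching_curve) = 3 \<longleftrightarrow> 2 * b * q < 1"
proof -
  define w where "w = (1 + sqrt (1 + 2 * b * q)) / q"
  define A where "A = {y. y < 0 \<and> (q * y + 1)\<^sup>2 = 1 - 2 * b * q}"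
  have bq: "0 < b * q" using assms by simp
  have "1 < sqrt (1 + 2 * b * q)" using bq by simp
  then have w: "0 < w" using assms by (simp add: w_def add_pos_pos)
  have pos: "y = - q * switch_fun y - b \<longleftrightarrow> y = w" if "0 \<le> y" for y
  proof -
    have "(q * y - 1)\<^sup>2 - (1 + 2 * b * q) = (- 2 * q) * (y - (- q * switch_fun y - b))"
      using that by (simp add: switch_fun_def power2_eq_square algebra_simps)
    then have "(q * y - 1)\<^sup>2 - (1 + 2 * b * q) = 0 \<longleftrightarrow> y - (- q * switch_fun y - b) = 0"
      using assms by (simp only: mult_eq_0_iff) simp
    then have "y = - q * switch_fun y - b \<longleftrightarrow> (q * y - 1)\<^sup>2 = 1 + 2 * b * q"
      unfolding right_minus_eq by blast
    also have "\<dots> \<longleftrightarrow> q * y - 1 = sqrt (1 + 2 * b * q)"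
    proof
      assume sq: "(q * y - 1)\<^sup>2 = 1 + 2 * b * q"
      have "0 \<le> q * y" using that assms by simp
      moreover have "\<bar>q * y - 1\<bar> = sqrt (1 + 2 * b * q)" using sq by (metis real_sqrt_abs)
      ultimately show "q * y - 1 = sqrt (1 + 2 * b * q)"
        using \<open>1 < sqrt (1 + 2 * b * q)\<close> by linarith
    qed (use bq in simp)
    also have "\<dots> \<longleftrightarrow> y = w"
      using assms by (auto simp: w_def field_simps)
    finally show ?thesis .
  qed
  have neg: "y = - q * switch_fun y - b \<longleftrightarrow> (q * y + 1)\<^sup>2 = 1 - 2 * b * q" if "y < 0" for y
  proof -
    have "(q * y + 1)\<^sup>2 - (1 - 2 * b * q) = (2 * q) * (y - (- q * switch_fun y - b))"
      using that by (simp add: switch_fun_def power2_eq_square algebra_simps)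
    then have "(q * y + 1)\<^sup>2 - (1 - 2 * b * q) = 0 \<longleftrightarrow> y - (- q * switch_fun y - b) = 0"
      using assms by (simp only: mult_eq_0_iff) simp
    then show ?thesis unfolding right_minus_eq by blast
  qed
  have "y = - q * switch_fun y - b \<longleftrightarrow> y \<in> insert w A" for y
    using pos[of y] neg[of y] w unfolding A_def by (cases "0 \<le> y") auto
  then have iff: "x = switch_fun y \<and> y = - q * x - b \<longleftrightarrow> x = switch_fun y \<and> y \<in> insert w A" for x y
    by blast
  have "boundary_line q b \<inter> switching_curve = (\<lambda>y. (switch_fun y, y)) ` insert w A"
  proof (intro set_eqI)
    fix p :: "real \<times> real"
    obtain x y where p: "p = (x, y)" by fastforce
    show "p \<in> boundary_line q b \<inter> switching_curve \<longleftrightarrow> p \<in> (\<lambda>y. (switch_fun y, y)) ` insert w A"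
      using iff[of x y] unfolding p boundary_line_def switching_curve_def image_iff
      by (simp only: Int_iff mem_Collect_eq case_prod_conv prod.inject bex_simps) blast
  qed
  then have card: "card (boundary_line q b \<inter> switching_curve) = card (insert w A)"
    by (simp add: card_image inj_on_def del: image_insert)
  show ?thesis
  proof (cases "2 * b * q < 1")
    case True
    define r where "r = sqrt (1 - 2 * b * q)"
    have r: "0 < r" "r < 1" "r\<^sup>2 = 1 - 2 * b * q"
      using True bq by (auto simp: r_def real_sqrt_lt_1_iff)
    have "A = {(- 1 + r) / q, (- 1 - r) / q}"
    proof (intro set_eqI iffI)
      fix y assume "y \<in> A"
      then have "(q * y + 1)\<^sup>2 = r\<^sup>2" by (simp add: A_def r)
      then have "q * y + 1 = r \<or> q * y + 1 = - r" by (simp add: power2_eq_iff)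
      then have "y * q = - 1 + r \<or> y * q = - 1 - r" by (auto simp: algebra_simps)
      then show "y \<in> {(- 1 + r) / q, (- 1 - r) / q}"
        using assms by (auto simp: eq_divide_eq)
    next
      fix y assume "y \<in> {(- 1 + r) / q, (- 1 - r) / q}"
      then have "q * y = - 1 + r \<or> q * y = - 1 - r" using assms by auto
      then have "q * y < 0 \<and> (q * y + 1)\<^sup>2 = r\<^sup>2" using r by auto
      then show "y \<in> A" using assms by (simp add: A_def r mult_less_0_iff)
    qed
    moreover have "(- 1 + r) / q \<noteq> (- 1 - r) / q" using r assms by auto
    moreover have "w \<notin> A" using w by (simp add: A_def)
    ultimately show ?thesis using card True by simp
  next
    case False
    have "A \<subseteq> {- 1 / q}"
    proof
      fix y assume "y \<in> A"
      then have "(q * y + 1)\<^sup>2 \<le> 0" using False by (simp add: A_def)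
      then have "q * y + 1 = 0" by simp
      then show "y \<in> {- 1 / q}" using assms by (simp add: field_simps)
    qed
    then have "insert w A \<subseteq> {w, - 1 / q}" by auto
    then have "card (insert w A) \<le> card {w, - 1 / q}" by (rule card_mono[rotated]) simp
    also have "\<dots> \<le> 2" by (simp add: card_insert_if)
    finally show ?thesis using card False by simp
  qed
qed

lemma y_F_bounds:
  fixes q b :: real
  assumes "0 < q" "0 < b" "2 * b * q < 1"
  shows "- 1 / q < y_F q b" "y_F q b < 0" "y_F q b = - q * ((y_F q b)\<^sup>2 / 2) - b"
    "(- y_F q b - b) / q = (y_F q b)\<^sup>2 / 2"
proof -
  define r where "r = sqrt (1 - 2 * b * q)"
  have "0 < b * q" using assms by simp
  then have r: "0 < r" "r < 1" "r\<^sup>2 = 1 - 2 * b * q"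
    using assms by (auto simp: r_def real_sqrt_lt_1_iff)
  have yF: "y_F q b = (- 1 + r) / q" by (simp add: y_F_def r_def)
  show "- 1 / q < y_F q b" "y_F q b < 0"
    using assms r by (auto simp: yF divide_simps)
  have "q * y_F q b + 1 = r" using assms by (simp add: yF)
  then have "(q * y_F q b + 1)\<^sup>2 = 1 - 2 * b * q" using r by simp
  then have "2 * q * (y_F q b + q * ((y_F q b)\<^sup>2 / 2) + b) = 0"
    by (simp add: power2_eq_square algebra_simps)
  then show line: "y_F q b = - q * ((y_F q b)\<^sup>2 / 2) - b" using assms by simp
  then have "- y_F q b - b = q * ((y_F q b)\<^sup>2 / 2)" by linarith
  then show "(- y_F q b - b) / q = (y_F q b)\<^sup>2 / 2" using assms by simp
qed

lemma boundary_segment_F_C: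
  fixes q b v :: real
  assumes qb: "0 < q" "0 < b" "2 * b * q < 1" and v: "- 1 / q \<le> v" "v \<le> y_F q b"
  shows "((- v - b) / q, v) \<in> closed_segment (point_F q b) (point_C q b)"
proof -
  define l where "l = (y_F q b - v) / (y_F q b + 1 / q)"
  note yF = y_F_bounds[OF qb]
  have d: "0 < y_F q b + 1 / q" using yF(1) by simp
  have l: "0 \<le> l" "l \<le> 1" using d v by (auto simp: l_def)
  have "l * (y_F q b + 1 / q) = y_F q b - v" using d by (simp add: l_def)
  then have v_eq: "v = (1 - l) * y_F q b + l * (- 1 / q)" by (simp add: algebra_simps)
  have F: "(1 / 2) * (y_F q b)\<^sup>2 = (- y_F q b - b) / q"
    using yF(4) by simp
  have C: "(1 - b * q) / q\<^sup>2 = (- (- 1 / q) - b) / q"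
    using qb by (simp add: field_simps power2_eq_square)
  have "(- v - b) / q = (1 - l) * ((- y_F q b - b) / q) + l * ((- (- 1 / q) - b) / q)"
    unfolding v_eq using qb by (simp add: field_simps)
  then show ?thesis
    unfolding closed_segment_def point_F_def point_C_def F C using l v_eq by auto
qed

section \<open>The state constraint along parabolas\<close>

text \<open>Along a parabola of the control \<open>-1\<close> the constraint function is concave in \<open>y\<close>.\<close>

lemma constraint_between:
  fixes q b c v v1 v2 :: real
  assumes "0 \<le> q" and v: "v1 \<le> v" "v \<le> v2"
    and h1: "v1 \<ge> - q * (c - v1\<^sup>2 / 2) - b" and h2: "v2 \<ge> - q * (c - v2\<^sup>2 / 2) - b"
  shows "v \<ge> - q * (c - v\<^sup>2 / 2) - b"
proof (cases "v1 = v2")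
  case False
  define h where "h w = w + q * (c - w\<^sup>2 / 2) + b" for w
  have "(v2 - v1) * h v = (v2 - v) * h v1 + (v - v1) * h v2 +
      (v2 - v1) * (q / 2) * ((v - v1) * (v2 - v))"
    by (simp add: h_def field_simps power2_eq_square)
  moreover have "0 \<le> (v2 - v) * h v1" "0 \<le> (v - v1) * h v2"
      "0 \<le> (v2 - v1) * (q / 2) * ((v - v1) * (v2 - v))"
    using assms by (auto simp: h_def)
  ultimately have "0 \<le> (v2 - v1) * h v" by linarith
  then have "0 \<le> h v" using False v by (simp add: zero_le_mult_iff)
  then show ?thesis by (simp add: h_def)
qed (use v h1 in auto)

lemma constraint_right_branch:
  fixes q b v :: real
  assumes qb: "0 < q" "0 < b" "2 * b * q < 1" and v: "y_F q b \<le> v"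
  shows "v \<ge> - q * (v\<^sup>2 / 2) - b"
proof -
  note yF = y_F_bounds[OF qb]
  have "- 2 \<le> q * (v + y_F q b)"
  proof -
    have "q * (- 1 / q + - 1 / q) \<le> q * (v + y_F q b)"
      using yF(1) v qb by (intro mult_left_mono) linarith+
    then show ?thesis using qb by (simp add: field_simps)
  qed
  then have "0 \<le> (v - y_F q b) * (2 + q * (v + y_F q b))" using v by simp
  moreover have "(v - y_F q b) * (2 + q * (v + y_F q b)) =
      2 * (v + q * (v\<^sup>2 / 2)) - 2 * (y_F q b + q * ((y_F q b)\<^sup>2 / 2))"
    by (simp add: field_simps power2_eq_square)
  moreover have "y_F q b + q * ((y_F q b)\<^sup>2 / 2) = - b" using yF(3) by linarith
  ultimately show ?thesis by simp
qed

lemma constraint_tangent_parabola: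
  fixes q b v :: real
  assumes "0 < q"
  shows "v \<ge> - q * (v\<^sup>2 / 2 + ((1 / q - b) / q - (1 / q)\<^sup>2 / 2)) - b"
proof -
  have "v + q * (v\<^sup>2 / 2 + ((1 / q - b) / q - (1 / q)\<^sup>2 / 2)) + b = q / 2 * (v + 1 / q)\<^sup>2"
    using assms by (simp add: field_simps power2_eq_square)
  moreover have "0 \<le> q / 2 * (v + 1 / q)\<^sup>2" using assms by simp
  ultimately show ?thesis by linarith
qed

section \<open>Synthesis with one switching\<close>

lemma free_candidate:
  fixes \<sigma> x0 y0 c r t1 T :: real
  assumes \<sigma>: "\<sigma> = 1 \<or> \<sigma> = - 1" and c: "c = \<sigma> * x0 + y0\<^sup>2 / 2" "0 \<le> c"
    and r: "r = sqrt c" "- r \<le> \<sigma> * y0" and times: "t1 = \<sigma> * y0 + r" "T = t1 + r"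
  shows "\<exists>X Y U. free_process x0 y0 T X Y U \<and> (\<forall>t\<in>{0..T}. Y t = - \<sigma> * r + \<sigma> * \<bar>t - t1\<bar>) \<and>
    (\<forall>t\<in>{0..t1}. X t = \<sigma> * (c - (Y t)\<^sup>2 / 2)) \<and> (\<forall>t\<in>{t1..T}. X t = \<sigma> * (Y t)\<^sup>2 / 2) \<and>
    (\<forall>t\<in>{0<..<t1}. U t = - \<sigma>) \<and> (\<forall>t\<in>{t1<..<T}. U t = \<sigma>)"
proof -
  have r2: "r\<^sup>2 = c" and r0: "0 \<le> r" using c r by auto
  have t1: "0 \<le> t1" "t1 \<le> T" using times r r0 by auto
  have \<sigma>': "- \<sigma> = 1 \<or> - \<sigma> = - 1" using \<sigma> by auto
  note s1 = bang_steering[OF t1(1) \<sigma>', of x0 y0]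
  note s2 = bang_steering[OF t1(2) \<sigma>, of "\<sigma> * r\<^sup>2 / 2" "- \<sigma> * r"]
  have y1: "y0 + - \<sigma> * (t1 - 0) = - \<sigma> * r + \<sigma> * (t1 - t1)"
    using \<sigma> by (auto simp: times)
  have x1: "x0 + y0 * (t1 - 0) + - \<sigma> * (t1 - 0)\<^sup>2 / 2 =
      \<sigma> * r\<^sup>2 / 2 + - \<sigma> * r * (t1 - t1) + \<sigma> * (t1 - t1)\<^sup>2 / 2"
    using \<sigma> r2 by (auto simp: times c(1) power2_eq_square field_simps)
  from steering_append[OF s1 s2 x1 y1] obtain X Y U where st: "steering 0 T X Y U"
    and l1: "\<And>t. t \<in> {0..t1} \<Longrightarrow> X t = x0 + y0 * t - \<sigma> * t\<^sup>2 / 2 \<and> Y t = y0 - \<sigma> * t \<and> U t = - \<sigma>"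
    and l2: "\<And>t. t \<in> {t1..T} \<Longrightarrow> X t = \<sigma> * r\<^sup>2 / 2 - \<sigma> * r * (t - t1) + \<sigma> * (t - t1)\<^sup>2 / 2 \<and>
      Y t = - \<sigma> * r + \<sigma> * (t - t1)"
    and U2: "\<And>t. t \<in> {t1<..T} \<Longrightarrow> U t = \<sigma>"
    by auto
  have "free_process x0 y0 T X Y U"
  proof (rule steering_imp_free_process[OF st])
    show "X 0 = x0" "Y 0 = y0" using l1[of 0] t1 by auto
    show "X T = 0" "Y T = 0"
      using l2[of T] t1 r0 by (auto simp: times(2) power2_eq_square)
  qed
  moreover have "Y t = - \<sigma> * r + \<sigma> * \<bar>t - t1\<bar>" if "t \<in> {0..T}" for t
    using l1[of t] l2[of t] that \<sigma> by (cases "t \<le> t1") (auto simp: times)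
  moreover have "X t = \<sigma> * (c - (Y t)\<^sup>2 / 2)" if "t \<in> {0..t1}" for t
    using l1[OF that] \<sigma> by (auto simp: c(1) field_simps power2_eq_square)
  moreover have "X t = \<sigma> * (Y t)\<^sup>2 / 2" if "t \<in> {t1..T}" for t
  proof -
    have "\<sigma> * r\<^sup>2 / 2 - \<sigma> * r * (t - t1) + \<sigma> * (t - t1)\<^sup>2 / 2 = \<sigma> * (- \<sigma> * r + \<sigma> * (t - t1))\<^sup>2 / 2"
      using \<sigma> by (auto simp: field_simps power2_eq_square)
    then show ?thesis using l2[OF that] by simp
  qed
  moreover have "U t = - \<sigma>" if "t \<in> {0<..<t1}" for t using l1[of t] that by auto
  moreover have "U t = \<sigma>" if "t \<in> {t1<..<T}" for t using U2[of t] that by auto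
  ultimately show ?thesis by blast
qed

text \<open>
  If the candidate of the free problem respects the state constraint, then it solves both problems.
\<close>

lemma free_synthesis:
  fixes \<sigma> x0 y0 c r q b :: real
  assumes "0 < b" and \<sigma>: "\<sigma> = 1 \<or> \<sigma> = - 1" and c: "c = \<sigma> * x0 + y0\<^sup>2 / 2" "0 \<le> c"
    and r: "r = sqrt c" "- r \<le> \<sigma> * y0"
    and leg1: "\<And>v. - r \<le> \<sigma> * v \<Longrightarrow> \<sigma> * v \<le> \<sigma> * y0 \<Longrightarrow> v \<ge> - q * (\<sigma> * (c - v\<^sup>2 / 2)) - b"
    and leg2: "\<And>v. - r \<le> \<sigma> * v \<Longrightarrow> \<sigma> * v \<le> 0 \<Longrightarrow> v \<ge> - q * (\<sigma> * v\<^sup>2 / 2) - b"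
  shows "(\<exists>T x y u. constrained_optimal q b x0 y0 T x y u) \<and>
    (\<forall>T x y u. constrained_optimal q b x0 y0 T x y u \<longleftrightarrow> free_optimal x0 y0 T x y u) \<and>
    (\<forall>T x y u. constrained_optimal q b x0 y0 T x y u \<longrightarrow> two_leg_control T u (- \<sigma>) \<sigma>)"
proof -
  define t1 where "t1 = \<sigma> * y0 + r"
  define T where "T = t1 + r"
  have r0: "0 \<le> r" using c r by simp
  have t1: "0 \<le> t1" "t1 \<le> T" using r r0 by (auto simp: t1_def T_def)
  obtain X Y U where pr: "free_process x0 y0 T X Y U"
    and Y: "\<And>t. t \<in> {0..T} \<Longrightarrow> Y t = - \<sigma> * r + \<sigma> * \<bar>t - t1\<bar>"
    and X1: "\<And>t. t \<in> {0..t1} \<Longrightarrow> X t = \<sigma> * (c - (Y t)\<^sup>2 / 2)"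
    and X2: "\<And>t. t \<in> {t1..T} \<Longrightarrow> X t = \<sigma> * (Y t)\<^sup>2 / 2"
    and U1: "\<And>t. t \<in> {0<..<t1} \<Longrightarrow> U t = - \<sigma>" and U2: "\<And>t. t \<in> {t1<..<T} \<Longrightarrow> U t = \<sigma>"
    using free_candidate[OF \<sigma> c r t1_def T_def] by blast
  have feasible: "Y t \<ge> - q * X t - b" if "t \<in> {0..T}" for t
  proof -
    have "\<sigma> * Y t = \<bar>t - t1\<bar> - r" using Y[OF that] \<sigma> by auto
    then have "- r \<le> \<sigma> * Y t" "t \<le> t1 \<Longrightarrow> \<sigma> * Y t \<le> \<sigma> * y0" "t1 \<le> t \<Longrightarrow> \<sigma> * Y t \<le> 0"
      using that by (auto simp: t1_def T_def)
    moreover have "X t = \<sigma> * (c - (Y t)\<^sup>2 / 2) \<and> t \<le> t1 \<or> X t = \<sigma> * (Y t)\<^sup>2 / 2 \<and> t1 \<le> t"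
      using X1[of t] X2[of t] that by (cases "t \<le> t1") auto
    ultimately show ?thesis using leg1[of "Y t"] leg2[of "Y t"] by metis
  qed
  have cpr: "constrained_process q b x0 y0 T X Y U"
    using pr feasible by (auto simp: constrained_process_def)
  have ends: "X 0 = x0" "Y 0 = y0" "X T = 0" "Y T = 0" using pr by (auto simp: free_process_def)
  have moving: "\<exists>t\<in>{s..T}. Y t \<noteq> 0" if s: "0 \<le> s" "s < T" for s
  proof (cases "r = 0")
    case True
    then have "Y s \<noteq> 0" using s Y[of s] \<sigma> by (auto simp: T_def)
    then show ?thesis using s by auto
  next
    case False
    then have "Y (max s t1) \<noteq> 0"
      using s Y[of "max s t1"] \<sigma> t1 r0 by (auto simp: T_def max_def)
    then show ?thesis using s t1 by (intro bexI[of _ "max s t1"]) auto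
  qed
  have eq: "T' = T \<and> (\<forall>t\<in>{0..T}. x t = X t \<and> y t = Y t)"
    if "free_process x0 y0 T' x y u" "T' \<le> T" for T' x y u
  proof (rule not_longer_process_eq[where P = "\<lambda>_ _. True", OF that(1) _ _ that(2) moving])
    fix x y t
    assume "trajectory 0 T x y" "x 0 = x0" "y 0 = y0" "x T = 0" "y T = 0" "t \<in> {0..T}"
    then show "x t = X t \<and> y t = Y t"
      using free_trajectory_unique[OF _ free_process_imp_trajectory[OF pr] \<sigma> _ Y, of x y t] t1 ends
      by auto
  qed auto
  have le: "T \<le> T'" if "free_process x0 y0 T' x y u" for T' x y u
    using eq[OF that] by linarith
  have opt: "constrained_optimal q b x0 y0 T X Y U"
    using cpr le by (auto simp: constrained_optimal_def constrained_process_def)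
  have iff: "constrained_optimal q b x0 y0 T' x y u \<longleftrightarrow> free_optimal x0 y0 T' x y u" for T' x y u
  proof
    assume co: "constrained_optimal q b x0 y0 T' x y u"
    then have "T' \<le> T" "free_process x0 y0 T' x y u"
      using cpr unfolding constrained_optimal_def constrained_process_def by blast+
    then show "free_optimal x0 y0 T' x y u"
      using le unfolding free_optimal_def by force
  next
    assume fo: "free_optimal x0 y0 T' x y u"
    then have "T' \<le> T" and fp: "free_process x0 y0 T' x y u"
      using pr unfolding free_optimal_def by blast+
    then have "T' = T" "\<forall>t\<in>{0..T}. x t = X t \<and> y t = Y t" using eq by auto
    then show "constrained_optimal q b x0 y0 T' x y u"
      using fp feasible le by (auto simp: constrained_optimal_def constrained_process_def)
  qed
  have "two_leg_control T' u (- \<sigma>) \<sigma>" if "constrained_optimal q b x0 y0 T' x y u" for T' x y u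
  proof -
    have "T' \<le> T" and fp: "free_process x0 y0 T' x y u"
      using that cpr unfolding constrained_optimal_def constrained_process_def by blast+
    then have T': "T' = T" "\<And>t. t \<in> {0..T} \<Longrightarrow> y t = Y t" using eq by auto
    have "control_on 0 t1 u (\<lambda>_. - \<sigma>)" "control_on t1 T u (\<lambda>_. \<sigma>)"
      by (rule process_control_on[OF fp[unfolded T'(1)] pr T'(2)]; use U1 U2 t1 in simp)+
    then show ?thesis using t1 T' by (auto simp: two_leg_control_def)
  qed
  then show ?thesis using opt iff by blast
qed

section \<open>Synthesis with a boundary arc\<close>

text \<open>
  The candidate: control \<open>-1\<close> down to the ordinate \<open>Y1\<close>, control \<open>+1\<close> up to the point of the boundary
  with ordinate \<open>Y2\<close>, the boundary arc to \<open>F\<close>, and control \<open>+1\<close> to the origin. The second leg is a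
  point, or it ends at the point of tangency \<open>C\<close>; otherwise it would violate the state constraint.
\<close>

lemma constrained_candidate:
  fixes q b x0 y0 Y1 Y2 t1 t2 t3 T :: real
  assumes qb: "0 < q" "0 < b" "2 * b * q < 1"
    and h0: "y0 \<ge> - q * x0 - b"
    and Y: "Y1 \<le> y0" "Y1 \<le> Y2" "- 1 / q \<le> Y2" "Y2 \<le> y_F q b"
    and alt: "Y1 = Y2 \<or> Y2 = - 1 / q"
    and energy: "x0 + y0\<^sup>2 / 2 = Y1\<^sup>2 + ((- Y2 - b) / q - Y2\<^sup>2 / 2)"
    and times: "t1 = y0 - Y1" "t2 = t1 + (Y2 - Y1)" "t3 = t2 + ln (Y2 / y_F q b) / q" "T = t3 - y_F q b"
  obtains X Y U where "0 \<le> t1" "t1 \<le> t2" "t2 \<le> t3" "t3 < T"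
    and "constrained_process q b x0 y0 T X Y U"
    and "\<And>t. t \<in> {0..t2} \<Longrightarrow> Y t = Y1 + \<bar>t - t1\<bar>"
    and "\<And>t. t \<in> {t1..t2} \<Longrightarrow> X t = (Y t)\<^sup>2 / 2 + ((- Y2 - b) / q - Y2\<^sup>2 / 2)"
    and "\<And>t. t \<in> {t2..t3} \<Longrightarrow> X t = (- Y t - b) / q \<and> Y t = Y2 * exp (- q * (t - t2))"
    and "\<And>t. t \<in> {t3..T} \<Longrightarrow> Y t = t - T" and "Y t3 = y_F q b"
    and "\<And>t. t \<in> {0<..<t1} \<Longrightarrow> U t = - 1" and "\<And>t. t \<in> {t1<..<t2} \<Longrightarrow> U t = 1"
    and "\<And>t. t \<in> {t2<..<t3} \<Longrightarrow> U t = - q * Y t" and "\<And>t. t \<in> {t3<..<T} \<Longrightarrow> U t = 1"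
proof -
  note yF = y_F_bounds[OF qb]
  have neg: "Y2 < 0" using Y yF by linarith
  define X2 where "X2 = (- Y2 - b) / q"
  define X1 where "X1 = Y1\<^sup>2 / 2 + (X2 - Y2\<^sup>2 / 2)"
  define xF where "xF = (y_F q b)\<^sup>2 / 2"
  have xF: "xF = (- y_F q b - b) / q" using yF(4) by (simp add: xF_def)
  have ratio: "1 \<le> Y2 / y_F q b" using Y yF neg by (simp add: le_divide_eq)
  have le: "0 \<le> t1" "t1 \<le> t2" "t2 \<le> t3" "t3 < T"
    using Y yF qb ratio by (auto simp: times)
  have "exp (- q * (t3 - t2)) = inverse (exp (ln (Y2 / y_F q b)))"
    using qb by (simp add: times exp_minus)
  also have "\<dots> = y_F q b / Y2" using ratio by (simp add: inverse_eq_divide)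
  finally have Y_t3: "Y2 * exp (- q * (t3 - t2)) = y_F q b" using neg by simp
  have "\<bar>q * Y2\<bar> = q * (- Y2)" using neg qb by (simp add: abs_mult)
  also have "\<dots> \<le> q * (1 / q)" using Y qb by (intro mult_left_mono) auto
  finally have small: "\<bar>q * Y2\<bar> \<le> 1" using qb by simp
  note s1 = bang_steering[OF le(1), of "- 1" x0 y0, simplified]
  note s2 = bang_steering[OF le(2), of 1 X1 Y1, simplified]
  note s3 = boundary_steering[OF qb(1) le(3) small, of b]
  note s4 = bang_steering[OF less_imp_le[OF le(4)], of 1 xF "y_F q b", simplified]
  have x1: "x0 + y0 * t1 - t1\<^sup>2 / 2 = X1 + Y1 * (t1 - t1) + (t1 - t1)\<^sup>2 / 2"
    and y1: "y0 - t1 = Y1 + (t1 - t1)"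
    using energy by (simp_all add: times(1) X1_def X2_def power2_eq_square field_simps)
  from steering_append[OF s1 s2] obtain x y u where s12: "steering 0 t2 x y u"
    and l1: "\<And>t. t \<in> {0..t1} \<Longrightarrow> x t = x0 + y0 * t - t\<^sup>2 / 2 \<and> y t = y0 - t \<and> u t = - 1"
    and l2: "\<And>t. t \<in> {t1..t2} \<Longrightarrow> x t = X1 + Y1 * (t - t1) + (t - t1)\<^sup>2 / 2 \<and> y t = Y1 + (t - t1)"
    and u2: "\<And>t. t \<in> {t1<..t2} \<Longrightarrow> u t = 1"
    using x1 y1 by auto
  have "X1 + Y1 * (Y2 - Y1) + (Y2 - Y1)\<^sup>2 / 2 = X2"
    by (simp add: X1_def power2_eq_square field_simps)
  then have "x t2 = X2" "y t2 = Y2"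
    using l2[of t2] le by (simp_all add: times(2))
  then have "x t2 = (- Y2 * exp (- q * (t2 - t2)) - b) / q" "y t2 = Y2 * exp (- q * (t2 - t2))"
    by (simp_all add: X2_def)
  from steering_append[OF s12 s3 this] obtain x' y' u' where s123: "steering 0 t3 x' y' u'"
    and m: "\<And>t. t \<in> {0..t2} \<Longrightarrow> x' t = x t \<and> y' t = y t \<and> u' t = u t"
    and l3: "\<And>t. t \<in> {t2..t3} \<Longrightarrow> x' t = (- Y2 * exp (- q * (t - t2)) - b) / q \<and>
      y' t = Y2 * exp (- q * (t - t2))"
    and u3: "\<And>t. t \<in> {t2<..t3} \<Longrightarrow> u' t = - q * (Y2 * exp (- q * (t - t2)))"
    by blast
  have "x' t3 = xF + y_F q b * (t3 - t3) + (t3 - t3)\<^sup>2 / 2" "y' t3 = y_F q b + (t3 - t3)"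
    using l3[of t3] le Y_t3 by (simp_all add: xF)
  from steering_append[OF s123 s4 this] obtain X Y U where st: "steering 0 T X Y U"
    and M: "\<And>t. t \<in> {0..t3} \<Longrightarrow> X t = x' t \<and> Y t = y' t \<and> U t = u' t"
    and l4: "\<And>t. t \<in> {t3..T} \<Longrightarrow> X t = xF + y_F q b * (t - t3) + (t - t3)\<^sup>2 / 2 \<and>
      Y t = y_F q b + (t - t3)"
    and u4: "\<And>t. t \<in> {t3<..T} \<Longrightarrow> U t = 1"
    by blast
  have L1: "X t = x0 + y0 * t - t\<^sup>2 / 2 \<and> Y t = y0 - t \<and> U t = - 1" if "t \<in> {0..t1}" for t
    using M[of t] m[of t] l1[of t] that le by auto
  have L2: "X t = X1 + Y1 * (t - t1) + (t - t1)\<^sup>2 / 2 \<and> Y t = Y1 + (t - t1)" if "t \<in> {t1..t2}" for t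
    using M[of t] m[of t] l2[of t] that le by auto
  have L3: "X t = (- Y t - b) / q \<and> Y t = Y2 * exp (- q * (t - t2))" if "t \<in> {t2..t3}" for t
    using M[of t] l3[of t] that le by auto
  have L4: "X t = (Y t)\<^sup>2 / 2 \<and> Y t = t - T" if "t \<in> {t3..T}" for t
  proof -
    have "xF + y_F q b * (t - t3) + (t - t3)\<^sup>2 / 2 = (y_F q b + (t - t3))\<^sup>2 / 2"
      by (simp add: xF_def power2_eq_square field_simps)
    then show ?thesis using l4[OF that] by (simp add: times(4))
  qed
  have XY2: "X t = (Y t)\<^sup>2 / 2 + (X2 - Y2\<^sup>2 / 2)" if "t \<in> {t1..t2}" for t
  proof -
    have "X1 + Y1 * (t - t1) + (t - t1)\<^sup>2 / 2 = (Y1 + (t - t1))\<^sup>2 / 2 + (X2 - Y2\<^sup>2 / 2)"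
      by (simp add: X1_def power2_eq_square field_simps)
    then show ?thesis using L2[OF that] by simp
  qed
  have pr: "free_process x0 y0 T X Y U"
    by (rule steering_imp_free_process[OF st]) (use L1[of 0] L4[of T] le in auto)
  have tangent: "v \<ge> - q * (v\<^sup>2 / 2 + (X2 - Y2\<^sup>2 / 2)) - b" if "Y1 \<le> v" "v \<le> Y2" for v
  proof (cases "Y1 = Y2")
    case True
    then have "v = Y2" using that by simp
    then show ?thesis using qb by (simp add: X2_def)
  next
    case False
    then have "Y2 = - 1 / q" using alt by simp
    then have "X2 - Y2\<^sup>2 / 2 = (1 / q - b) / q - (1 / q)\<^sup>2 / 2" by (simp add: X2_def)
    then show ?thesis using constraint_tangent_parabola[OF qb(1), of v b] by simp
  qed
  have feasible: "Y t \<ge> - q * X t - b" if t: "t \<in> {0..T}" for t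
  proof -
    consider "t \<in> {0..t1}" | "t \<in> {t1..t2}" | "t \<in> {t2..t3}" | "t \<in> {t3..T}" using t by force
    then show ?thesis
    proof cases
      case 1
      define c where "c = x0 + y0\<^sup>2 / 2"
      have "x0 + y0 * t - t\<^sup>2 / 2 = c - (y0 - t)\<^sup>2 / 2"
        by (simp add: c_def power2_eq_square field_simps)
      then have X: "X t = c - (Y t)\<^sup>2 / 2" and Yt: "Y t = y0 - t" using L1[OF 1] by simp_all
      have "c - Y1\<^sup>2 / 2 = Y1\<^sup>2 / 2 + (X2 - Y2\<^sup>2 / 2)"
        using energy unfolding X2_def c_def by linarith
      then have "Y1 \<ge> - q * (c - Y1\<^sup>2 / 2) - b"
        using tangent[OF order_refl Y(2)] by metis
      moreover have "y0 \<ge> - q * (c - y0\<^sup>2 / 2) - b" using h0 by (simp add: c_def)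
      moreover have "Y1 \<le> Y t" "Y t \<le> y0" using 1 by (auto simp: Yt times(1))
      ultimately show ?thesis
        unfolding X using constraint_between[of q Y1 "Y t" y0 c b] qb by linarith
    next
      case 2
      then have "Y1 \<le> Y t" "Y t \<le> Y2" using L2[OF 2] by (auto simp: times(2))
      then show ?thesis unfolding XY2[OF 2] by (rule tangent)
    next
      case 3
      then show ?thesis using L3[OF 3] qb by simp
    next
      case 4
      have "y_F q b \<le> Y t" using L4[OF 4] 4 by (auto simp: times(4))
      then show ?thesis
        unfolding conjunct1[OF L4[OF 4]] by (rule constraint_right_branch[OF qb])
    qed
  qed
  have cpr: "constrained_process q b x0 y0 T X Y U"
    unfolding constrained_process_def using pr feasible by blast
  have Y12: "Y t = Y1 + \<bar>t - t1\<bar>" if "t \<in> {0..t2}" for t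
  proof (cases "t \<le> t1")
    case True
    then have "Y t = y0 - t" using L1[of t] that by simp
    then show ?thesis using True by (simp add: times(1))
  next
    case False
    then have "Y t = Y1 + (t - t1)" using L2[of t] that by simp
    then show ?thesis using False by simp
  qed
  have Y_eq: "Y t3 = y_F q b" using L3[of t3] le Y_t3 by simp
  have U2: "U t = 1" if "t \<in> {t1<..<t2}" for t
  proof -
    have "U t = u' t" "u' t = u t" "u t = 1" using M[of t] m[of t] u2[of t] that le by simp_all
    then show ?thesis by simp
  qed
  have U3: "U t = - q * Y t" if "t \<in> {t2<..<t3}" for t
  proof -
    have "U t = u' t" "u' t = - q * (Y2 * exp (- q * (t - t2)))" "Y t = Y2 * exp (- q * (t - t2))"
      using M[of t] u3[of t] L3[of t] that le by simp_all
    then show ?thesis by simp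
  qed
  show ?thesis
  proof (rule that[OF le cpr Y12 _ L3 _ Y_eq _ U2 U3])
    show "U t = - 1" if "t \<in> {0<..<t1}" for t using L1[of t] that by simp
    show "U t = 1" if "t \<in> {t3<..<T}" for t using u4[of t] that by simp
    show "X t = (Y t)\<^sup>2 / 2 + ((- Y2 - b) / q - Y2\<^sup>2 / 2)" if "t \<in> {t1..t2}" for t
      using XY2[OF that] by (simp only: X2_def)
    show "Y t = t - T" if "t \<in> {t3..T}" for t using L4[OF that] by simp
  qed
qed

lemma constrained_synthesis:
  fixes q b x0 y0 Y1 Y2 :: real
  assumes qb: "0 < q" "0 < b" "2 * b * q < 1"
    and h0: "y0 \<ge> - q * x0 - b"
    and Y: "Y1 \<le> y0" "Y1 \<le> Y2" "- 1 / q \<le> Y2" "Y2 \<le> y_F q b"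
    and alt: "Y1 = Y2 \<or> Y2 = - 1 / q"
    and energy: "x0 + y0\<^sup>2 / 2 = Y1\<^sup>2 + ((- Y2 - b) / q - Y2\<^sup>2 / 2)"
  shows constrained_optimal_exists: "\<exists>T x y u. constrained_optimal q b x0 y0 T x y u"
    and constrained_optimal_structure: "constrained_optimal q b x0 y0 T' x y u \<Longrightarrow>
      \<exists>t1 t2 t3. 0 \<le> t1 \<and> t2 - t1 = Y2 - Y1 \<and> t2 \<le> t3 \<and> t3 \<le> T' \<and>
        control_on 0 t1 u (\<lambda>_. - 1) \<and>
        (\<forall>r\<in>{t1..t2}. x r = (y r)\<^sup>2 / 2 + ((- Y2 - b) / q - Y2\<^sup>2 / 2) \<and> y r \<le> Y2) \<and>
        control_on t1 t2 u (\<lambda>_. 1) \<and> (x t2, y t2) = ((- Y2 - b) / q, Y2) \<and>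
        boundary_leg_to_F q b t2 t3 x y u \<and> control_on t3 T' u (\<lambda>_. 1)"
proof -
  note yF = y_F_bounds[OF qb]
  define t1 where "t1 = y0 - Y1"
  define t2 where "t2 = t1 + (Y2 - Y1)"
  define t3 where "t3 = t2 + ln (Y2 / y_F q b) / q"
  define T where "T = t3 - y_F q b"
  obtain X Y U where le: "0 \<le> t1" "t1 \<le> t2" "t2 \<le> t3" "t3 < T"
    and cpr: "constrained_process q b x0 y0 T X Y U"
    and Y12: "\<And>t. t \<in> {0..t2} \<Longrightarrow> Y t = Y1 + \<bar>t - t1\<bar>"
    and XY2: "\<And>t. t \<in> {t1..t2} \<Longrightarrow> X t = (Y t)\<^sup>2 / 2 + ((- Y2 - b) / q - Y2\<^sup>2 / 2)"
    and XY3: "\<And>t. t \<in> {t2..t3} \<Longrightarrow> X t = (- Y t - b) / q \<and> Y t = Y2 * exp (- q * (t - t2))"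
    and Y4: "\<And>t. t \<in> {t3..T} \<Longrightarrow> Y t = t - T" and Y_t3: "Y t3 = y_F q b"
    and U1: "\<And>t. t \<in> {0<..<t1} \<Longrightarrow> U t = - 1" and U2: "\<And>t. t \<in> {t1<..<t2} \<Longrightarrow> U t = 1"
    and U3: "\<And>t. t \<in> {t2<..<t3} \<Longrightarrow> U t = - q * Y t" and U4: "\<And>t. t \<in> {t3<..<T} \<Longrightarrow> U t = 1"
  proof (rule constrained_candidate[OF qb h0 Y alt energy t1_def t2_def t3_def T_def], goal_cases)
    case (1 X Y U)
    from 1(2-15) show ?case by (rule 1(1))
  qed
  have pr: "free_process x0 y0 T X Y U" using cpr by (simp add: constrained_process_def)
  have ends: "X 0 = x0" "Y 0 = y0" "X T = 0" "Y T = 0" using pr by (auto simp: free_process_def)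
  have moving: "\<exists>t\<in>{s..T}. Y t \<noteq> 0" if s: "0 \<le> s" "s < T" for s
    using Y4[of "max s t3"] s le by (intro bexI[of _ "max s t3"]) auto
  have eq: "T' = T \<and> (\<forall>t\<in>{0..T}. x t = X t \<and> y t = Y t)"
    if "constrained_process q b x0 y0 T' x y u" "T' \<le> T" for T' x y u
  proof (rule not_longer_process_eq[where P = "\<lambda>x y. y \<ge> - q * x - b", OF _ _ _ that(2) moving])
    fix x y t
    assume tr: "trajectory 0 T x y" and y: "\<And>t. t \<in> {0..T} \<Longrightarrow> y t \<ge> - q * x t - b"
      and xy: "x 0 = x0" "y 0 = y0" "x T = 0" "y T = 0" "t \<in> {0..T}"
    have arc2: "Y t = - q * X t - b" if "t \<in> {t2..t3}" for t
      using XY3[OF that] qb by simp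
    have arc3: "Y t = - (T - t3) + \<bar>t - t3\<bar>" if "t \<in> {t3..T}" for t
      using Y4[OF that] that by simp
    show "x t = X t \<and> y t = Y t"
      using constrained_trajectory_unique[OF qb(1) tr free_process_imp_trajectory[OF pr]
          le(1-3) less_imp_le[OF le(4)] Y12 arc2 arc3 y] xy ends by simp
  qed (use that qb in \<open>auto simp: constrained_process_def\<close>)
  have opt: "constrained_optimal q b x0 y0 T X Y U"
    unfolding constrained_optimal_def using cpr eq by (metis linorder_le_cases)
  then show "\<exists>T x y u. constrained_optimal q b x0 y0 T x y u" by blast
  assume co: "constrained_optimal q b x0 y0 T' x y u"
  then have "T' \<le> T" and cp: "constrained_process q b x0 y0 T' x y u"
    using cpr unfolding constrained_optimal_def by blast+
  then have T': "T' = T" and xy: "\<And>t. t \<in> {0..T} \<Longrightarrow> x t = X t" "\<And>t. t \<in> {0..T} \<Longrightarrow> y t = Y t"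
    using eq by auto
  have fp: "free_process x0 y0 T x y u" using cp T' by (simp add: constrained_process_def)
  note control = process_control_on[OF fp pr xy(2)]
  have on: "x t = (- y t - b) / q" "y t = Y2 * exp (- q * (t - t2))" if "t \<in> {t2..t3}" for t
    using XY3[OF that] xy[of t] that le by auto
  have neg: "Y2 < 0" using Y yF by linarith
  have y_less: "y s < y t" if "s \<in> {t2..t3}" "t \<in> {t2..t3}" "s < t" for s t
    using on(2)[OF that(1)] on(2)[OF that(2)] that(3) neg qb by simp
  have y_t2: "y t2 = Y2" using on(2)[of t2] le by simp
  have y_t3: "y t3 = y_F q b" using xy(2)[of t3] Y_t3 le by simp
  have leg: "boundary_leg_to_F q b t2 t3 x y u"
    unfolding boundary_leg_to_F_def
  proof (intro conjI ballI)
    fix r assume r: "r \<in> {t2..t3}"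
    have "Y2 \<le> y r" "y r \<le> y_F q b"
      using y_less[of t2 r] y_less[of r t3] r le y_t2 y_t3 by (cases "r = t2"; cases "r = t3"; force)+
    then show "(x r, y r) \<in> closed_segment (point_F q b) (point_C q b)"
      using boundary_segment_F_C[OF qb, of "y r"] Y on(1)[OF r] by simp
  next
    show "strict_mono_on {t2..t3} y" using y_less by (intro strict_mono_onI) blast
    show "strict_antimono_on {t2..t3} x"
    proof (rule monotone_onI)
      fix s t assume "s \<in> {t2..t3}" "t \<in> {t2..t3}" "s < t"
      then show "x t < x s" using y_less[of s t] on(1)[of s] on(1)[of t] qb by (simp add: divide_strict_right_mono)
    qed
    show "control_on t2 t3 u (\<lambda>r. - q * y r)"
      by (rule control) (use U3 xy le in auto)
    show "(x t3, y t3) = point_F q b"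
      using on(1)[of t3] le y_t3 yF(4) by (simp add: point_F_def)
  qed
  have arc: "x r = (y r)\<^sup>2 / 2 + ((- Y2 - b) / q - Y2\<^sup>2 / 2) \<and> y r \<le> Y2" if "r \<in> {t1..t2}" for r
    using XY2[OF that] Y12[of r] xy[of r] that le by (auto simp: t2_def)
  have c1: "control_on 0 t1 u (\<lambda>_. - 1)" and c2: "control_on t1 t2 u (\<lambda>_. 1)"
    and c3: "control_on t3 T u (\<lambda>_. 1)"
    by (rule control; use U1 U2 U4 le in simp)+
  have "(x t2, y t2) = ((- Y2 - b) / q, Y2)" using on(1)[of t2] y_t2 le by simp
  moreover have "t2 - t1 = Y2 - Y1" by (simp add: t2_def)
  ultimately show "\<exists>t1 t2 t3. 0 \<le> t1 \<and> t2 - t1 = Y2 - Y1 \<and> t2 \<le> t3 \<and> t3 \<le> T' \<and>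
      control_on 0 t1 u (\<lambda>_. - 1) \<and>
      (\<forall>r\<in>{t1..t2}. x r = (y r)\<^sup>2 / 2 + ((- Y2 - b) / q - Y2\<^sup>2 / 2) \<and> y r \<le> Y2) \<and>
      control_on t1 t2 u (\<lambda>_. 1) \<and> (x t2, y t2) = ((- Y2 - b) / q, Y2) \<and>
      boundary_leg_to_F q b t2 t3 x y u \<and> control_on t3 T' u (\<lambda>_. 1)"
    using le(1,3) less_imp_le[OF le(4)] c1 c2 c3 leg arc unfolding T' by blast
qed

section \<open>The optimal synthesis\<close>

text \<open>
  In \<open>\<Omega>\<^sub>1\<close> and \<open>\<Omega>\<^sub>2\<close> the number \<open>r\<close> is the absolute value of the ordinate at which the switching curve
  is met. In \<open>\<Omega>\<^sub>2\<close> it is at most \<open>- y_F\<close>, so the trajectory meets the curve at \<open>F\<close> or above it.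
\<close>

lemma synthesis_Omega1:
  fixes q b x0 y0 :: real
  assumes qb: "0 < q" "0 < b" "2 * b * q < 1" and \<Omega>: "(x0, y0) \<in> Omega1 q b"
  shows "(\<exists>T x y u. constrained_optimal q b x0 y0 T x y u) \<and>
    (\<forall>T x y u. constrained_optimal q b x0 y0 T x y u \<longleftrightarrow> free_optimal x0 y0 T x y u) \<and>
    (\<forall>T x y u. constrained_optimal q b x0 y0 T x y u \<longrightarrow> two_leg_control T u 1 (- 1))"
proof -
  note yF = y_F_bounds[OF qb]
  have h0: "y0 \<ge> - q * x0 - b" and y0: "y_F q b \<le> y0" and x0: "x0 \<le> switch_fun y0"
    using \<Omega> by (auto simp: Omega1_def)
  define c where "c = - 1 * x0 + y0\<^sup>2 / 2"
  define r where "r = sqrt c"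
  have "switch_fun y0 \<le> y0\<^sup>2 / 2" by (simp add: switch_fun_def)
  then have c0: "0 \<le> c" using x0 unfolding c_def by linarith
  have r0: "0 \<le> r" using c0 by (simp add: r_def)
  have y0r: "- r \<le> - 1 * y0"
  proof (cases "0 \<le> y0")
    case True
    then have "y0\<^sup>2 \<le> c" using x0 by (simp add: c_def switch_fun_def)
    then show ?thesis using real_le_rsqrt[of y0 c] by (simp add: r_def)
  qed (use r0 in simp)
  have up: "v \<ge> - q * (- 1 * (c - v\<^sup>2 / 2)) - b" if "y0 \<le> v" for v
  proof -
    \<comment> \<open>above the ordinate of \<open>C\<close> the control \<open>+1\<close> increases the constraint function\<close>
    have "q * (- 1 / q + - 1 / q) \<le> q * (v + y0)"
      using yF(1) y0 that qb by (intro mult_left_mono) linarith+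
    then have "0 \<le> 2 + q * (v + y0)" using qb by (simp add: field_simps)
    then have "0 \<le> (v - y0) * (2 + q * (v + y0))" using that by simp
    also have "\<dots> = 2 * ((v - (- q * (- 1 * (c - v\<^sup>2 / 2)) - b)) - (y0 - (- q * x0 - b)))"
      by (simp add: c_def field_simps power2_eq_square)
    finally have "y0 - (- q * x0 - b) \<le> v - (- q * (- 1 * (c - v\<^sup>2 / 2)) - b)"
      by (simp only: zero_le_mult_iff) simp
    moreover have "0 \<le> y0 - (- q * x0 - b)" using h0 by simp
    ultimately have "0 \<le> v - (- q * (- 1 * (c - v\<^sup>2 / 2)) - b)" by (rule order_trans[rotated])
    then show ?thesis unfolding diff_ge_0_iff_ge .
  qed
  have top: "r \<ge> - q * (0 - r\<^sup>2 / 2) - b"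
  proof -
    have "r\<^sup>2 = c" using c0 by (simp add: r_def)
    then show ?thesis using up[of r] y0r by simp
  qed
  have right: "v \<ge> - q * (- 1 * v\<^sup>2 / 2) - b" if "- r \<le> - 1 * v" "- 1 * v \<le> 0" for v
    using constraint_between[of q 0 v r 0 b, OF _ _ _ _ top] that qb by simp
  have left: "v \<ge> - q * (- 1 * (c - v\<^sup>2 / 2)) - b" if "- r \<le> - 1 * v" "- 1 * v \<le> - 1 * y0" for v
    using up[of v] that by simp
  show ?thesis
    by (rule free_synthesis[OF qb(2) disjI2[OF refl] c_def c0 r_def y0r left right, unfolded minus_minus])
qed

lemma synthesis_Omega2:
  fixes q b x0 y0 :: real
  assumes qb: "0 < q" "0 < b" "2 * b * q < 1" and \<Omega>: "(x0, y0) \<in> Omega2 q b"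
  shows "(\<exists>T x y u. constrained_optimal q b x0 y0 T x y u) \<and>
    (\<forall>T x y u. constrained_optimal q b x0 y0 T x y u \<longleftrightarrow> free_optimal x0 y0 T x y u) \<and>
    (\<forall>T x y u. constrained_optimal q b x0 y0 T x y u \<longrightarrow> two_leg_control T u (- 1) 1)"
proof -
  note yF = y_F_bounds[OF qb]
  have h0: "y0 \<ge> - q * x0 - b" and y0: "y_F q b \<le> y0" and x0: "switch_fun y0 \<le> x0"
    and x0': "x0 \<le> (y_F q b)\<^sup>2 - (1 / 2) * y0\<^sup>2"
    using \<Omega> by (auto simp: Omega2_def)
  define c where "c = 1 * x0 + y0\<^sup>2 / 2"
  define r where "r = sqrt c"
  have "- (y0\<^sup>2 / 2) \<le> switch_fun y0" by (simp add: switch_fun_def)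
  then have c0: "0 \<le> c" using x0 unfolding c_def by linarith
  have r0: "0 \<le> r" and r2: "r\<^sup>2 = c" using c0 by (simp_all add: r_def)
  have "c \<le> (- y_F q b)\<^sup>2" using x0' by (simp add: c_def)
  then have rF: "y_F q b \<le> - r" using real_le_lsqrt[of "- y_F q b" c] yF by (simp add: r_def)
  have y0r: "- r \<le> 1 * y0"
  proof (cases "0 \<le> y0")
    case False
    then have "(- y0)\<^sup>2 \<le> c" using x0 by (simp add: c_def switch_fun_def)
    then have "- y0 \<le> sqrt c" by (rule real_le_rsqrt)
    then show ?thesis by (simp add: r_def)
  qed (use r0 in simp)
  have right: "v \<ge> - q * (1 * v\<^sup>2 / 2) - b" if "- r \<le> 1 * v" "1 * v \<le> 0" for v
    using constraint_right_branch[OF qb, of v] that rF by simp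
  have bottom: "- r \<ge> - q * (c - (- r)\<^sup>2 / 2) - b"
    using constraint_right_branch[OF qb rF] r2 by simp
  have start: "y0 \<ge> - q * (c - y0\<^sup>2 / 2) - b" using h0 by (simp add: c_def)
  have left: "v \<ge> - q * (1 * (c - v\<^sup>2 / 2)) - b" if "- r \<le> 1 * v" "1 * v \<le> 1 * y0" for v
    using constraint_between[of q "- r" v y0 c b, OF _ _ _ bottom start] that qb by simp
  show ?thesis
    by (rule free_synthesis[OF qb(2) disjI1[OF refl] c_def c0 r_def y0r left right])
qed

lemma synthesis_Omega3:
  fixes q b x0 y0 :: real
  assumes qb: "0 < q" "0 < b" "2 * b * q < 1" and \<Omega>: "(x0, y0) \<in> Omega3 q b"
  shows "(\<exists>T x y u. constrained_optimal q b x0 y0 T x y u) \<and>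
    (\<forall>T x y u. constrained_optimal q b x0 y0 T x y u \<longrightarrow> synthesis3 q b T x y u)"
proof -
  note yF = y_F_bounds[OF qb]
  have h0: "y0 \<ge> - q * x0 - b" and y0: "- 1 / q \<le> y0" and x0: "x0 \<le> n_C q b - (1 / 2) * y0\<^sup>2"
    and x0': "y_F q b \<le> y0 \<Longrightarrow> (y_F q b)\<^sup>2 - (1 / 2) * y0\<^sup>2 \<le> x0"
    using \<Omega> by (auto simp: Omega3_def)
  define c where "c = x0 + y0\<^sup>2 / 2"
  \<comment> \<open>\<open>Y\<close> is the lower ordinate at which the parabola \<open>x = c - y\<^sup>2 / 2\<close> meets the boundary line\<close>
  define D where "D = 1 / q\<^sup>2 + 2 * b / q + 2 * c"
  define Y where "Y = 1 / q - sqrt D"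
  have square: "(1 / q - w)\<^sup>2 = 1 / q\<^sup>2 + 2 * b / q + 2 * (w\<^sup>2 / 2 + (- w - b) / q)" for w
    using qb by (simp add: field_simps power2_eq_square)
  have below: "Y \<le> w" if "w\<^sup>2 / 2 + (- w - b) / q \<le> c" for w
  proof -
    have "(1 / q - w)\<^sup>2 \<le> D" unfolding D_def square using that by (intro add_left_mono mult_left_mono) auto
    then show ?thesis using real_le_rsqrt[of "1 / q - w" D] by (simp add: Y_def)
  qed
  have F: "(y_F q b)\<^sup>2 / 2 + (- y_F q b - b) / q = (y_F q b)\<^sup>2"
    unfolding yF(4) by simp
  have YF: "Y \<le> y_F q b"
  proof (cases "y_F q b \<le> y0")
    case True
    then show ?thesis using below[of "y_F q b"] x0' by (simp add: F c_def)
  next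
    case False
    have "y0\<^sup>2 / 2 + (- y0 - b) / q \<le> c" using h0 qb by (simp add: c_def divide_le_eq algebra_simps)
    then show ?thesis using below[of y0] False by linarith
  qed
  have Y0: "Y \<le> y0"
  proof (cases "y_F q b \<le> y0")
    case False
    have "y0\<^sup>2 / 2 + (- y0 - b) / q \<le> c" using h0 qb by (simp add: c_def divide_le_eq algebra_simps)
    then show ?thesis using below[of y0] by linarith
  qed (use YF in linarith)
  have "0 \<le> D"
  proof (rule ccontr)
    assume "\<not> 0 \<le> D"
    then have "sqrt D < 0" by simp
    moreover have "0 < 1 / q" using qb by simp
    ultimately have "0 < Y" unfolding Y_def by linarith
    then show False using YF yF by linarith
  qed
  then have "(1 / q - Y)\<^sup>2 = D" by (simp add: Y_def)
  then have "1 / q\<^sup>2 + 2 * b / q + 2 * (Y\<^sup>2 / 2 + (- Y - b) / q) = D"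
    by (simp only: square)
  then have "2 * (Y\<^sup>2 / 2 + (- Y - b) / q) = 2 * c" unfolding D_def by (rule add_left_imp_eq)
  then have "Y\<^sup>2 / 2 + (- Y - b) / q = c" by (simp only: mult_cancel_left) simp
  moreover have "Y\<^sup>2 + (z - Y\<^sup>2 / 2) = Y\<^sup>2 / 2 + z" for z by simp
  ultimately have energy: "x0 + y0\<^sup>2 / 2 = Y\<^sup>2 + ((- Y - b) / q - Y\<^sup>2 / 2)"
    unfolding c_def by metis
  have "D \<le> 1 / q\<^sup>2 + 2 * b / q + 2 * n_C q b" using x0 by (simp add: D_def c_def)
  also have "\<dots> = (2 / q)\<^sup>2"
    using qb by (simp add: n_C_def field_simps power2_eq_square)
  finally have "sqrt D \<le> 2 / q" using qb by (intro real_le_lsqrt) simp_all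
  then have CY: "- 1 / q \<le> Y" by (simp add: Y_def)
  note synthesis = constrained_synthesis[OF qb h0 Y0 order_refl CY YF disjI1[OF refl] energy]
  show ?thesis
  proof (intro conjI allI impI)
    show "\<exists>T x y u. constrained_optimal q b x0 y0 T x y u" by (rule synthesis(1))
    fix T x y u assume "constrained_optimal q b x0 y0 T x y u"
    from synthesis(2)[OF this] obtain t1 t2 t3 where
      "0 \<le> t1" "t2 - t1 = Y - Y" "t2 \<le> t3" "t3 \<le> T" "control_on 0 t1 u (\<lambda>_. - 1)"
      "boundary_leg_to_F q b t2 t3 x y u" "control_on t3 T u (\<lambda>_. 1)"
      by blast
    then show "synthesis3 q b T x y u"
      unfolding synthesis3_def by (intro exI[of _ t1] exI[of _ t3]) simp
  qed
qed

lemma synthesis_Omega4: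
  fixes q b x0 y0 :: real
  assumes qb: "0 < q" "0 < b" "2 * b * q < 1" and \<Omega>: "(x0, y0) \<in> Omega4 q b"
  shows "(\<exists>T x y u. constrained_optimal q b x0 y0 T x y u) \<and>
    (\<forall>T x y u. constrained_optimal q b x0 y0 T x y u \<longrightarrow> synthesis4 q b T x y u)"
proof -
  note yF = y_F_bounds[OF qb]
  define m where "m = (1 - 2 * b * q) / (2 * q\<^sup>2)"
  define c where "c = x0 + y0\<^sup>2 / 2"
  \<comment> \<open>\<open>Y\<close> is the ordinate at which the parabola \<open>x = c - y\<^sup>2 / 2\<close> meets the arc below \<open>C\<close>\<close>
  define Y where "Y = - sqrt (c - m)"
  have h0: "y0 \<ge> - q * x0 - b"
    and cases: "- 1 / q \<le> y0 \<and> n_C q b \<le> c \<or> y0 \<le> - 1 / q \<and> y0\<^sup>2 / 2 + m \<le> x0"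
    using \<Omega> by (auto simp: Omega4_def m_def c_def)
  have n: "n_C q b - m = (1 / q)\<^sup>2"
    using qb by (simp add: n_C_def m_def field_simps power2_eq_square)
  have "(1 / q)\<^sup>2 \<le> c - m \<and> Y \<le> y0"
    using cases
  proof
    assume *: "- 1 / q \<le> y0 \<and> n_C q b \<le> c"
    then have "(1 / q)\<^sup>2 \<le> c - m" using n by linarith
    moreover from this have "1 / q \<le> sqrt (c - m)" by (rule real_le_rsqrt)
    ultimately show ?thesis using * by (simp add: Y_def)
  next
    assume *: "y0 \<le> - 1 / q \<and> y0\<^sup>2 / 2 + m \<le> x0"
    then have y0: "(- y0)\<^sup>2 \<le> c - m" by (simp add: c_def)
    then have "- y0 \<le> sqrt (c - m)" by (rule real_le_rsqrt)
    moreover have "(1 / q)\<^sup>2 \<le> (- y0)\<^sup>2" using * qb by (intro power_mono) auto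
    ultimately show ?thesis using y0 by (simp add: Y_def)
  qed
  then have sq: "(1 / q)\<^sup>2 \<le> c - m" and Y0: "Y \<le> y0" by auto
  have "1 / q \<le> sqrt (c - m)" using sq by (rule real_le_rsqrt)
  then have YC: "Y \<le> - 1 / q" by (simp add: Y_def)
  have "0 \<le> c - m" using sq zero_le_power2[of "1 / q"] by linarith
  then have "Y\<^sup>2 = c - m" by (simp add: Y_def)
  moreover have m: "(- (- 1 / q) - b) / q - (- 1 / q)\<^sup>2 / 2 = m"
    using qb by (simp add: m_def field_simps power2_eq_square)
  ultimately have energy: "x0 + y0\<^sup>2 / 2 = Y\<^sup>2 + ((- (- 1 / q) - b) / q - (- 1 / q)\<^sup>2 / 2)"
    by (simp only: c_def)
  have C: "((- (- 1 / q) - b) / q, - 1 / q) = point_C q b"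
    using qb by (simp add: point_C_def field_simps power2_eq_square)
  note synthesis = constrained_synthesis[OF qb h0 Y0 YC order_refl less_imp_le[OF yF(1)]
      disjI2[OF refl] energy]
  show ?thesis
  proof (intro conjI allI impI)
    show "\<exists>T x y u. constrained_optimal q b x0 y0 T x y u" by (rule synthesis(1))
    fix T x y u assume "constrained_optimal q b x0 y0 T x y u"
    from synthesis(2)[OF this] obtain t1 t2 t3 where
      t: "0 \<le> t1" "t2 - t1 = - 1 / q - Y" "t2 \<le> t3" "t3 \<le> T" and
      c1: "control_on 0 t1 u (\<lambda>_. - 1)" and
      arc: "\<And>r. r \<in> {t1..t2} \<Longrightarrow> x r = (y r)\<^sup>2 / 2 + m \<and> y r \<le> - 1 / q" and
      c2: "control_on t1 t2 u (\<lambda>_. 1)" and at_C: "(x t2, y t2) = point_C q b" and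
      leg: "boundary_leg_to_F q b t2 t3 x y u" and c3: "control_on t3 T u (\<lambda>_. 1)"
      unfolding m C by blast
    have "(x r, y r) \<in> arc_CC'' q b" if "r \<in> {t1..t2}" for r
      using arc[OF that] by (simp add: arc_CC''_def m_def)
    moreover have "t1 \<le> t2" using t(2) YC by linarith
    ultimately show "synthesis4 q b T x y u"
      unfolding synthesis4_def using t(1,3,4) c1 c2 c3 at_C leg by blast
  qed
qed

theorem theorem4:
  fixes q b :: real
  assumes "0 < q" and "0 < b"
  shows "(card (boundary_line q b \<inter> switching_curve) = 3 \<longleftrightarrow> 2 * b * q < 1) \<and>
    (card (boundary_line q b \<inter> switching_curve) = 3 \<longrightarrow>
      (\<forall>(x0, y0) \<in> Omega1 q b \<union> Omega2 q b.
        (\<exists>T x y u. constrained_optimal q b x0 y0 T x y u) \<and>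
        (\<forall>T x y u. constrained_optimal q b x0 y0 T x y u \<longleftrightarrow> free_optimal x0 y0 T x y u) \<and>
        (\<forall>T x y u. constrained_optimal q b x0 y0 T x y u \<longrightarrow>
           two_leg_control T u (- 1) 1 \<or> two_leg_control T u 1 (- 1))) \<and>
      (\<forall>(x0, y0) \<in> Omega3 q b.
        (\<exists>T x y u. constrained_optimal q b x0 y0 T x y u) \<and>
        (\<forall>T x y u. constrained_optimal q b x0 y0 T x y u \<longrightarrow> synthesis3 q b T x y u)) \<and>
      (\<forall>(x0, y0) \<in> Omega4 q b.
        (\<exists>T x y u. constrained_optimal q b x0 y0 T x y u) \<and>
        (\<forall>T x y u. constrained_optimal q b x0 y0 T x y u \<longrightarrow> synthesis4 q b T x y u)))"
proof -
  have card: "card (boundary_line q b \<inter> switching_curve) = 3 \<longleftrightarrow> 2 * b * q < 1"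
    using boundary_line_Int_switching_curve assms by blast
  show ?thesis
    unfolding card
  proof (intro conjI impI ballI, goal_cases)
    case 1
    show ?case by (rule refl)
  next
    case (2 p)
    then have qb: "0 < q" "0 < b" "2 * b * q < 1" using assms by simp_all
    obtain x0 y0 where p: "p = (x0, y0)" by fastforce
    show ?case
      using 2 synthesis_Omega1[OF qb, of x0 y0] synthesis_Omega2[OF qb, of x0 y0]
      unfolding p by auto
  next
    case (3 p)
    then have qb: "0 < q" "0 < b" "2 * b * q < 1" using assms by simp_all
    obtain x0 y0 where p: "p = (x0, y0)" by fastforce
    show ?case using 3(2) synthesis_Omega3[OF qb, of x0 y0] unfolding p by simp
  next
    case (4 p)
    then have qb: "0 < q" "0 < b" "2 * b * q < 1" using assms by simp_all
    obtain x0 y0 where p: "p = (x0, y0)" by fastforce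
    show ?case using 4(2) synthesis_Omega4[OF qb, of x0 y0] unfolding p by simp
  qed
qed

end
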